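(* Let $A_Q=R/I_Q$ be an almost Gorenstein algebra with graded minimal free resolution $$0 \to F_c \to F_{c-1} \to \cdots \to F_2 \to F_1 \to R \to A_Q \to 0.$$ Suppose that a minimal set of generators of $I_Q$ is $(f_1,\ldots,f_n,f)$, where $(f_1,\ldots,f_n)$ is a minimal set of generators of a Gorenstein ideal $I_Z$ of codimension $c$. Let $K_\bullet$ be a graded minimal free resolution of $A_Z=R/I_Z$ and let $G_\bullet$ be a graded minimal free resolution of $A_G=R/I_G$, where $I_G=I_Z:I_Q$. Put $d^*=\deg f$ and $d=\vartheta_Z+d^*$. Then $$F_2 \cong F_c^{\vee}(-d)\oplus F_2' \cong G_1(-d^* )\oplus K_2'$$ for some graded free module $F_2'$ and some direct summand $K_2'$ of $K_2$.
   Context: $k$ is an infinite field and $R=k[x_1,\ldots,x_c]$, $c\ge 3$, is the standard graded polynomial ring; all ideals and generators are homogeneous. A standard graded artinian algebra $A_Q=R/I_Q$ is an almost Gorenstein algebra if $I_Q=I_Z+(f)$ with $I_Z$ a Gorenstein ideal of codimension $c$ (i.e. $R/I_Z$ is artinian Gorenstein), $f\in(x_1,\ldots,x_c)$, $f\notin I_Z$, and $A_Q$ is not Gorenstein. For a graded free module $F$, $F^\vee=\operatorname{Hom}_R(F,R)$. Resolutions are indexed so that $K_\bullet$ is $0\to K_c\to\cdots\to K_1\to R\to R/I_Z\to 0$, and similarly for $G_\bullet$ and $R/I_G$. $\vartheta_Z$ is the degree of the only last syzygy of $I_Z$, i.e. $K_c\cong R(-\vartheta_Z)$; $I_G$ is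 a Gorenstein ideal of codimension $c$ and $\vartheta_G$ is defined analogously for it; one has $\vartheta_G=\vartheta_Z-d^*$, so $d=2\vartheta_Z-\vartheta_G=\vartheta_Z+d^*$. *)

theory Defs
  imports Main "HOL-Library.Cardinality" "HOL-Library.Poly_Mapping" "Jordan_Normal_Form.Matrix_Kernel"
begin

section \<open>The standard graded polynomial ring\<close>

text \<open>The variables are the elements of the finite type \<open>'v\<close>, so that
  \<open>('v, 'k) mpoly\<close> is the polynomial ring over \<open>'k\<close> in \<open>CARD('v)\<close> variables;
  an exponent vector has type \<open>'v \<Rightarrow>\<^sub>0 nat\<close>.\<close>

type_synonym ('v, 'k) mpoly = "('v \<Rightarrow>\<^sub>0 nat) \<Rightarrow>\<^sub>0 'k"

definition const :: "'k::field \<Rightarrow> ('v::finite, 'k) mpoly" where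
  "const a = Poly_Mapping.single 0 a"

definition var :: "'v::finite \<Rightarrow> ('v, 'k::field) mpoly" where
  "var x = Poly_Mapping.single (Poly_Mapping.single x 1) 1"

definition mdeg :: "('v::finite \<Rightarrow>\<^sub>0 nat) \<Rightarrow> nat" where
  "mdeg m = (\<Sum>x\<in>UNIV. Poly_Mapping.lookup m x)"

text \<open>Membership in the graded piece \<open>R\<^sub>d\<close>. The zero polynomial lies in every piece, and \<open>R\<^sub>d = 0\<close>
  for \<open>d < 0\<close>.\<close>

definition hom_of_degree :: "int \<Rightarrow> ('v::finite, 'k::field) mpoly \<Rightarrow> bool" where
  "hom_of_degree d p \<longleftrightarrow> (\<forall>m\<in>Poly_Mapping.keys p. int (mdeg m) = d)"

definition homogeneous :: "('v::finite, 'k::field) mpoly \<Rightarrow> bool" where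
  "homogeneous p \<longleftrightarrow> (\<exists>d. hom_of_degree d p)"

section \<open>Ideals\<close>

text \<open>Ideals are the submodules of the ring regarded as a module over itself.\<close>

abbreviation is_ideal :: "'r::comm_ring_1 set \<Rightarrow> bool" where
  "is_ideal \<equiv> Modules.module.subspace (*)"

abbreviation ideal_gen :: "'r::comm_ring_1 set \<Rightarrow> 'r set" where
  "ideal_gen \<equiv> Modules.module.span (*)"

definition irrelevant_ideal :: "('v::finite, 'k::field) mpoly set" where
  "irrelevant_ideal = ideal_gen (range var)"

definition homogeneous_ideal :: "('v::finite, 'k::field) mpoly set \<Rightarrow> bool" where
  "homogeneous_ideal I \<longleftrightarrow> (\<exists>S. (\<forall>s\<in>S. homogeneous s) \<and> I = ideal_gen S)"

definition colon :: "'r::comm_ring_1 set \<Rightarrow> 'r set \<Rightarrow> 'r set" where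
  "colon I J = {r. \<forall>q\<in>J. r * q \<in> I}"

definition minimal_generators ::
    "('v::finite, 'k::field) mpoly set \<Rightarrow> ('v, 'k) mpoly list \<Rightarrow> bool" where
  "minimal_generators I gs \<longleftrightarrow>
     (\<forall>g\<in>set gs. homogeneous g) \<and> distinct gs \<and>
     ideal_gen (set gs) = I \<and> (\<forall>S. S \<subset> set gs \<longrightarrow> ideal_gen S \<noteq> I)"

text \<open>\<open>R/I\<close> is an artinian ring: the ideals of \<open>R/I\<close> are the ideals of \<open>R\<close> containing \<open>I\<close>, and they
  satisfy the descending chain condition.\<close>

definition artinian_quotient :: "'r::comm_ring_1 set \<Rightarrow> bool" where
  "artinian_quotient I \<longleftrightarrow>
     (\<forall>J :: nat \<Rightarrow> 'r set. (\<forall>i. is_ideal (J i) \<and> I \<subseteq> J i) \<and> decseq J \<longrightarrow>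
        (\<exists>N. \<forall>i\<ge>N. J i = J N))"

text \<open>\<open>I\<close> is a (homogeneous) Gorenstein ideal of codimension \<open>CARD('v)\<close>: the graded algebra \<open>R/I\<close> is
  artinian and its socle \<open>(I : (x\<^sub>1, \<dots>, x\<^sub>c)) / I\<close> is a one-dimensional \<open>k\<close>-vector space. This
  forces \<open>I \<noteq> R\<close>.\<close>

definition gorenstein_ideal :: "('v::finite, 'k::field) mpoly set \<Rightarrow> bool" where
  "gorenstein_ideal I \<longleftrightarrow>
     homogeneous_ideal I \<and> artinian_quotient I \<and>
     (\<exists>s \<in> colon I irrelevant_ideal. s \<notin> I \<and>
        (\<forall>t \<in> colon I irrelevant_ideal. \<exists>a. t - const a * s \<in> I))"

text \<open>\<open>R/I\<close> is an almost Gorenstein algebra.\<close>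

definition almost_gorenstein :: "('v::finite, 'k::field) mpoly set \<Rightarrow> bool" where
  "almost_gorenstein I \<longleftrightarrow>
     homogeneous_ideal I \<and> artinian_quotient I \<and> \<not> gorenstein_ideal I \<and>
     (\<exists>J f. gorenstein_ideal J \<and> homogeneous f \<and> f \<in> irrelevant_ideal \<and> f \<notin> J \<and>
        I = ideal_gen (J \<union> {f}))"

section \<open>Graded free modules\<close>

text \<open>\<open>Free [a\<^sub>1, \<dots>, a\<^sub>r]\<close> is the graded module \<open>R(-a\<^sub>1) \<oplus> \<dots> \<oplus> R(-a\<^sub>r)\<close>, \<open>a\<^sub>i\<close> being the degree of the
  \<open>i\<close>-th basis element. Its elements are the vectors in \<open>carrier_vec r\<close> over the polynomial ring.
  The type parameters are phantom: they record the ring \<open>R\<close>.\<close>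

datatype ('v, 'k) graded_free = Free (degs: "int list")

definition rank :: "('v, 'k) graded_free \<Rightarrow> nat" where
  "rank F = length (degs F)"

text \<open>The homogeneous elements of degree \<open>m\<close>; recall \<open>R(-a)\<^sub>m = R\<^bsub>m-a\<^esub>\<close>.\<close>

definition hcomp :: "('v::finite, 'k::field) graded_free \<Rightarrow> int \<Rightarrow> ('v, 'k) mpoly vec set" where
  "hcomp F m = {v \<in> carrier_vec (rank F). \<forall>i<rank F. hom_of_degree (m - degs F ! i) (v $ i)}"

text \<open>\<open>R\<close>-linear maps between free modules are given by matrices; a graded homomorphism is one that
  preserves degrees.\<close>

definition graded_hom ::
    "('v::finite, 'k::field) graded_free \<Rightarrow> ('v, 'k) graded_free \<Rightarrow> ('v, 'k) mpoly mat \<Rightarrow> bool" where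
  "graded_hom F G A \<longleftrightarrow>
     A \<in> carrier_mat (rank G) (rank F) \<and> (\<forall>m. \<forall>v\<in>hcomp F m. A *\<^sub>v v \<in> hcomp G m)"

definition graded_iso ::
    "('v::finite, 'k::field) graded_free \<Rightarrow> ('v, 'k) graded_free \<Rightarrow> bool"  (infix "\<cong>\<^sub>g" 50) where
  "F \<cong>\<^sub>g G \<longleftrightarrow>
     (\<exists>A B. graded_hom F G A \<and> graded_hom G F B \<and> B * A = 1\<^sub>m (rank F) \<and> A * B = 1\<^sub>m (rank G))"

definition dsum ::
    "('v, 'k) graded_free \<Rightarrow> ('v, 'k) graded_free \<Rightarrow> ('v, 'k) graded_free"  (infixr "\<oplus>\<^sub>g" 65) where
  "F \<oplus>\<^sub>g G = Free (degs F @ degs G)"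

text \<open>\<open>shift F s\<close> is \<open>F(s)\<close>, where \<open>F(s)\<^sub>m = F\<^bsub>m+s\<^esub>\<close>.\<close>

definition shift :: "('v, 'k) graded_free \<Rightarrow> int \<Rightarrow> ('v, 'k) graded_free" where
  "shift F s = Free (map (\<lambda>a. a - s) (degs F))"

text \<open>The dual \<open>Hom\<^sub>R(F, R)\<close>, written in the dual basis: \<open>Hom\<^sub>R(R(-a), R) = R(a)\<close>. Lemma \<open>hcomp_dual\<close>
  below states that its piece of degree \<open>m\<close> consists of the graded homomorphisms
  \<open>F \<rightarrow> R(m)\<close>, a functional being identified with the single row of its matrix.\<close>

definition dual :: "('v, 'k) graded_free \<Rightarrow> ('v, 'k) graded_free" where
  "dual F = Free (map uminus (degs F))"

text \<open>A direct summand of a finitely generated graded free module is, like its complement, graded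
  free, so nothing is lost by letting \<open>M\<close> and \<open>N\<close> range over graded free modules.\<close>

definition direct_summand ::
    "('v::finite, 'k::field) graded_free \<Rightarrow> ('v, 'k) graded_free \<Rightarrow> bool" where
  "direct_summand M F \<longleftrightarrow> (\<exists>N. F \<cong>\<^sub>g M \<oplus>\<^sub>g N)"

section \<open>Minimal free resolutions\<close>

text \<open>\<open>0 \<rightarrow> F\<^sub>c \<rightarrow> \<dots> \<rightarrow> F\<^sub>1 \<rightarrow> F\<^sub>0 = R \<rightarrow> R/I \<rightarrow> 0\<close> is a graded minimal free resolution with differentials
  \<open>\<delta> i : F\<^sub>i \<rightarrow> F\<^bsub>i-1\<^esub>\<close>. Minimality is \<open>\<delta> i (F\<^sub>i) \<subseteq> \<mm> F\<^bsub>i-1\<^esub>\<close>, where \<open>\<mm>\<close> is the irrelevant ideal.\<close>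

definition minimal_resolution ::
    "nat \<Rightarrow> ('v::finite, 'k::field) mpoly set \<Rightarrow>
     (nat \<Rightarrow> ('v, 'k) graded_free) \<Rightarrow> (nat \<Rightarrow> ('v, 'k) mpoly mat) \<Rightarrow> bool" where
  "minimal_resolution c I F \<delta> \<longleftrightarrow>
     F 0 = Free [0] \<and>
     (\<forall>i\<in>{1..c}. graded_hom (F i) (F (i - 1)) (\<delta> i)) \<and>
     (\<lambda>v. \<delta> 1 *\<^sub>v v) ` carrier_vec (rank (F 1)) = {w \<in> carrier_vec 1. w $ 0 \<in> I} \<and>
     (\<forall>i\<in>{1..<c}. (\<lambda>v. \<delta> (i + 1) *\<^sub>v v) ` carrier_vec (rank (F (i + 1))) = mat_kernel (\<delta> i)) \<and>
     mat_kernel (\<delta> c) = {0\<^sub>v (rank (F c))} \<and>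
     (\<forall>i\<in>{1..c}. elements_mat (\<delta> i) \<subseteq> irrelevant_ideal)"

section \<open>The dual module as a module of homomorphisms\<close>

lemma hom_of_degree_0 [simp]: "hom_of_degree d 0"
  by (simp add: hom_of_degree_def)

lemma hom_of_degree_add:
  assumes "hom_of_degree d p" "hom_of_degree d q"
  shows "hom_of_degree d (p + q)"
  using assms Poly_Mapping.keys_add[of p q] by (auto simp: hom_of_degree_def)

lemma hom_of_degree_sum:
  assumes "\<And>i. i \<in> A \<Longrightarrow> hom_of_degree d (f i)"
  shows "hom_of_degree d (sum f A)"
  using assms by (induction A rule: infinite_finite_induct) (auto intro: hom_of_degree_add)

lemma hom_of_degree_mult:
  assumes "hom_of_degree d p" "hom_of_degree e q"
  shows "hom_of_degree (d + e) (p * q)"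
  unfolding hom_of_degree_def
proof
  fix m assume "m \<in> Poly_Mapping.keys (p * q)"
  then obtain a b where "m = a + b" "a \<in> Poly_Mapping.keys p" "b \<in> Poly_Mapping.keys q"
    using Poly_Mapping.keys_mult[of p q] by blast
  then show "int (mdeg m) = d + e"
    using assms by (auto simp: hom_of_degree_def mdeg_def lookup_add sum.distrib)
qed

lemma hom_of_degree_1: "hom_of_degree 0 1"
  by (simp add: hom_of_degree_def mdeg_def)

lemma hcomp_dual:
  assumes A: "A \<in> carrier_mat 1 (rank F)"
  shows "row A 0 \<in> hcomp (dual F) m \<longleftrightarrow> graded_hom F (shift (Free [0]) m) A"
proof
  assume r: "row A 0 \<in> hcomp (dual F) m"
  have h: "hom_of_degree (m + degs F ! i) (A $$ (0, i))" if "i < rank F" for i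
    using r that A by (auto simp: hcomp_def dual_def rank_def)
  have "hom_of_degree (n + m) ((A *\<^sub>v v) $ 0)" if v: "v \<in> hcomp F n" for v n
  proof -
    have "(A *\<^sub>v v) $ 0 = (\<Sum>i<rank F. A $$ (0, i) * v $ i)"
      using A v by (auto simp: hcomp_def scalar_prod_def atLeast0LessThan)
    moreover have "hom_of_degree (n + m) (A $$ (0, i) * v $ i)" if "i < rank F" for i
    proof -
      have "hom_of_degree (n - degs F ! i) (v $ i)"
        using v that by (auto simp: hcomp_def)
      from hom_of_degree_mult[OF h[OF that] this] show ?thesis by (simp add: add.commute)
    qed
    ultimately show ?thesis by (auto intro!: hom_of_degree_sum)
  qed
  then show "graded_hom F (shift (Free [0]) m) A"
    using A by (auto simp: graded_hom_def shift_def hcomp_def rank_def)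
next
  assume g: "graded_hom F (shift (Free [0]) m) A"
  have "hom_of_degree (m + degs F ! i) (A $$ (0, i))" if i: "i < rank F" for i
  proof -
    have "unit_vec (rank F) i \<in> hcomp F (degs F ! i)"
      using i by (auto simp: hcomp_def unit_vec_def hom_of_degree_1)
    then have "A *\<^sub>v unit_vec (rank F) i \<in> hcomp (shift (Free [0]) m) (degs F ! i)"
      using g by (auto simp: graded_hom_def)
    then have "hom_of_degree (degs F ! i + m) ((A *\<^sub>v unit_vec (rank F) i) $ 0)"
      by (auto simp: hcomp_def shift_def rank_def)
    moreover have "(A *\<^sub>v unit_vec (rank F) i) $ 0 = A $$ (0, i)"
      using A i by simp
    ultimately show ?thesis by (simp add: add.commute)
  qed
  then show "row A 0 \<in> hcomp (dual F) m"
    using A by (auto simp: hcomp_def dual_def rank_def intro!: carrier_vecI)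
qed

end

theory Submission
  imports Defs "HOL-Library.Countable" "HOL-Combinatorics.Permutations"
begin

text \<open>
  Projecting a syzygy of \<open>(f\<^sub>1, \<dots>, f\<^sub>n, f)\<close> to its last coordinate gives an exact sequence
  \<open>0 \<rightarrow> Syz(I\<^sub>Z) \<rightarrow> Syz(I\<^sub>Q) \<rightarrow> I\<^sub>G(-d\<^sup>*) \<rightarrow> 0\<close>, and minimality of the generators puts all these syzygies
  into \<open>\<mm>\<close> times the free module. Reducing modulo \<open>\<mm>\<close> shows that, degree by degree, \<open>F\<^sub>2\<close> has at
  least as many basis elements as \<open>G\<^sub>1(-d\<^sup>*)\<close> and at most as many as \<open>K\<^sub>2 \<oplus> G\<^sub>1(-d\<^sup>*)\<close>; graded free modules
  with the same degrees are isomorphic, which gives the second decomposition.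
  For the first it remains to compare \<open>F\<^sub>c\<close> with \<open>G\<^sub>1\<close>. A diagram chase in the tensor product with the
  Koszul complex embeds \<open>F\<^sub>c/\<mm>F\<^sub>c\<close> into the socle of \<open>R/I\<^sub>Q\<close>, with a shift by \<open>c\<close>. The Gorenstein pairing
  of \<open>R/I\<^sub>Z\<close> makes this socle dual to a quotient of \<open>I\<^sub>G/\<mm>I\<^sub>G\<close>, so the basis elements of \<open>F\<^sub>c\<close> in degree
  \<open>t\<close> are at most as many as those of \<open>G\<^sub>1\<close> in degree \<open>\<theta>\<^sub>Z - t\<close>.\<close>

section \<open>Homogeneous components and the irrelevant ideal\<close>

text \<open>Both decompositions are assertions about multisets of basis degrees, so no comparison
  map has to be split as a map of modules; inverses modulo \<mm> suffice. The module
  \<open>K 2\<close> contributes only a summand because a minimal syzygy of \<open>I_Z\<close> can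
  cease to be minimal over \<open>I_Q\<close>: for I_Z = (x^2, y^2, z^2) and f = xy the Koszul
  syzygy of x^2 and y^2 is a combination of the syzygies coming from x, y in I_G. Generators of
  \<open>I_G\<close> cannot be lost in this way, since they are read off from the coefficient at
  \<open>f\<close>. The obstacle is that each resolution brings its own generators, whereas
  minimality is assumed for \<open>fs @ [f]\<close>. The comparison therefore runs through base
  changes between different generating sets, which need not be square. The Koszul complex enters
  since Tor_c(k, R/I) can be computed from the last module of the resolution or as the socle of R/I
  shifted by c. Applied to \<open>I_Z\<close>, the same embedding gives theta_Z = \<sigma> + c with
  \<sigma> the socle degree of R/I_Z.\<close>

interpretation ideal: module "(*) :: 'r::comm_ring_1 \<Rightarrow> 'r \<Rightarrow> 'r"
  by unfold_locales (auto simp: algebra_simps)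

declare ideal.scale_scale [simp del] \<comment> \<open>loops with mult.assoc\<close>

lemma is_ideal_mult_left: "is_ideal I \<Longrightarrow> p \<in> I \<Longrightarrow> r * p \<in> I"
  by (rule ideal.subspace_scale)

lemma is_ideal_mult_right: "is_ideal I \<Longrightarrow> p \<in> I \<Longrightarrow> p * r \<in> I"
  using ideal.subspace_scale[of I p r] by (simp add: mult.commute)

lemma mpoly_sum_single: "(\<Sum>m\<in>Poly_Mapping.keys p. Poly_Mapping.single m (Poly_Mapping.lookup p m)) = p"
  by (rule poly_mapping_eqI)
    (auto simp: lookup_sum lookup_single when_def in_keys_iff)

lemma mpoly_mult_expand:
  fixes p q :: "('v::finite, 'k::field) mpoly"
  shows "p * q = (\<Sum>m\<in>Poly_Mapping.keys p. \<Sum>n\<in>Poly_Mapping.keys q.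
    Poly_Mapping.single (m + n) (Poly_Mapping.lookup p m * Poly_Mapping.lookup q n))"
proof -
  have "p * q = (\<Sum>m\<in>Poly_Mapping.keys p. Poly_Mapping.single m (Poly_Mapping.lookup p m)) *
      (\<Sum>m\<in>Poly_Mapping.keys q. Poly_Mapping.single m (Poly_Mapping.lookup q m))"
    by (simp only: mpoly_sum_single)
  then show ?thesis
    by (simp add: sum_product mult_single)
qed

lemma mpoly_exponent_add_eq_0: "m + n = 0 \<longleftrightarrow> m = 0 \<and> n = 0" for m n :: "'v::finite \<Rightarrow>\<^sub>0 nat"
  by (auto simp: poly_mapping_eq_iff fun_eq_iff lookup_add)

lemma lookup_mult_0:
  fixes p q :: "('v::finite, 'k::field) mpoly"
  shows "Poly_Mapping.lookup (p * q) 0 = Poly_Mapping.lookup p 0 * Poly_Mapping.lookup q 0"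
proof -
  let ?P = "Poly_Mapping.keys p" and ?Q = "Poly_Mapping.keys q"
  have "Poly_Mapping.lookup (p * q) 0 = (\<Sum>m\<in>?P. \<Sum>n\<in>?Q.
      (if m = 0 then Poly_Mapping.lookup p m else 0) * (if n = 0 then Poly_Mapping.lookup q n else 0))"
    unfolding mpoly_mult_expand[of p q]
    by (auto simp: lookup_sum lookup_single when_def mpoly_exponent_add_eq_0 intro!: sum.cong)
  also have "\<dots> = (\<Sum>m\<in>?P. if m = 0 then Poly_Mapping.lookup p m else 0) *
      (\<Sum>n\<in>?Q. if n = 0 then Poly_Mapping.lookup q n else 0)"
    by (simp only: sum_product)
  also have "\<dots> = Poly_Mapping.lookup p 0 * Poly_Mapping.lookup q 0"
    by (auto simp: in_keys_iff)
  finally show ?thesis .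
qed

lemma lookup_const_mult [simp]:
  "Poly_Mapping.lookup (const a * p) m = a * Poly_Mapping.lookup p m"
  for p :: "('v::finite, 'k::field) mpoly"
proof -
  have "const a * p = (\<Sum>m\<in>Poly_Mapping.keys p. Poly_Mapping.single m (a * Poly_Mapping.lookup p m))"
    using mpoly_mult_expand[of "const a" p] by (cases "a = 0") (auto simp: const_def)
  then show ?thesis
    by (auto simp: lookup_sum lookup_single when_def in_keys_iff)
qed

lemma lookup_const_0 [simp]: "Poly_Mapping.lookup (const a) 0 = a"
  by (simp add: const_def)

lemma const_0 [simp]: "const 0 = 0"
  by (simp add: const_def)

lemma const_1 [simp]: "const 1 = 1"
  by (simp add: const_def)

lemma const_add: "const (a + b) = const a + const b"
  by (simp add: const_def single_add)

lemma const_diff: "const (a - b) = const a - const b"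
  by (simp add: const_def single_diff)

lemma const_mult: "const (a * b) = const a * const b"
  by (simp add: const_def mult_single)

lemma hom_of_degree_const: "hom_of_degree 0 (const a)"
  by (simp add: hom_of_degree_def mdeg_def const_def)

lemma hom_of_degree_uminus: "hom_of_degree d p \<Longrightarrow> hom_of_degree d (- p)"
  by (simp add: hom_of_degree_def in_keys_iff)

lemma hom_of_degree_diff: "hom_of_degree d p \<Longrightarrow> hom_of_degree d q \<Longrightarrow> hom_of_degree d (p - q)"
  using hom_of_degree_add[of d p "- q"] hom_of_degree_uminus[of d q] by simp

lemma hom_of_degree_const_mult: "hom_of_degree d p \<Longrightarrow> hom_of_degree d (const a * p)"
  using hom_of_degree_mult[OF hom_of_degree_const] by fastforce

lemma mdeg_add: "mdeg (m + n) = mdeg m + mdeg n"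
  by (simp add: mdeg_def lookup_add sum.distrib)

lemma mdeg_eq_0: "mdeg m = 0 \<longleftrightarrow> m = 0"
  by (auto simp: mdeg_def poly_mapping_eq_iff fun_eq_iff)

lemma mdeg_single [simp]: "mdeg (Poly_Mapping.single x n) = n"
  by (simp add: mdeg_def lookup_single when_def)

lemma hom_of_degree_single: "hom_of_degree (int (mdeg m)) (Poly_Mapping.single m a)"
  by (simp add: hom_of_degree_def)

lemma hom_of_degree_var: "hom_of_degree 1 (var x)"
  using hom_of_degree_single[of "Poly_Mapping.single x 1"] by (simp add: var_def)

lemma hom_of_degree_lookup_0:
  "hom_of_degree d p \<Longrightarrow> Poly_Mapping.lookup p 0 \<noteq> 0 \<Longrightarrow> d = 0"
  by (force simp: hom_of_degree_def in_keys_iff mdeg_def)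

lemma hom_of_degree_0_const:
  assumes "hom_of_degree 0 p"
  shows "p = const (Poly_Mapping.lookup p 0)"
proof (rule poly_mapping_eqI)
  fix m
  show "Poly_Mapping.lookup p m = Poly_Mapping.lookup (const (Poly_Mapping.lookup p 0)) m"
    using assms mdeg_eq_0[of m]
    by (cases "m \<in> Poly_Mapping.keys p") (auto simp: hom_of_degree_def const_def lookup_single when_def in_keys_iff)
qed

lemma monomial_factor_var:
  assumes "m \<noteq> (0 :: 'v::finite \<Rightarrow>\<^sub>0 nat)"
  obtains x n where "m = Poly_Mapping.single x 1 + n"
proof -
  from assms obtain x where x: "Poly_Mapping.lookup m x \<noteq> 0"
    by (metis lookup_zero poly_mapping_eqI)
  have "m = Poly_Mapping.single x 1 + (m - Poly_Mapping.single x 1)"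
    using x by (intro poly_mapping_eqI) (auto simp: lookup_add lookup_minus lookup_single when_def)
  then show ?thesis by (rule that)
qed

lemma is_ideal_irrelevant: "is_ideal irrelevant_ideal"
  by (simp add: irrelevant_ideal_def)

text \<open>A monomial other than 1 is divisible by a variable. Reduction modulo \<mm> thus becomes
  the constant coefficient, which is multiplicative by \<open>lookup_mult_0\<close>.\<close>

lemma irrelevant_ideal_iff: "p \<in> irrelevant_ideal \<longleftrightarrow> Poly_Mapping.lookup p 0 = 0"
proof
  assume "p \<in> irrelevant_ideal"
  then have "p \<in> ideal_gen (range var)" by (simp add: irrelevant_ideal_def)
  then show "Poly_Mapping.lookup p 0 = 0"
  proof (induction rule: ideal.span_induct_alt)
    case (step c x y)
    then show ?case
      by (auto simp: lookup_add lookup_mult_0 var_def lookup_single when_def poly_mapping_eq_iff fun_eq_iff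
          split: if_splits)
  qed simp
next
  assume p: "Poly_Mapping.lookup p 0 = 0"
  have "Poly_Mapping.single m (Poly_Mapping.lookup p m) \<in> irrelevant_ideal"
    if "m \<in> Poly_Mapping.keys p" for m
  proof -
    have "m \<noteq> 0" using that p by (auto simp: in_keys_iff)
    then obtain x n where m: "m = Poly_Mapping.single x 1 + n" by (rule monomial_factor_var)
    have "Poly_Mapping.single m (Poly_Mapping.lookup p m) =
        Poly_Mapping.single n (Poly_Mapping.lookup p m) * var x"
      by (simp add: m var_def mult_single add.commute)
    then show ?thesis
      unfolding irrelevant_ideal_def by (simp add: ideal.span_scale ideal.span_base)
  qed
  then have "(\<Sum>m\<in>Poly_Mapping.keys p. Poly_Mapping.single m (Poly_Mapping.lookup p m)) \<in> irrelevant_ideal"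
    by (intro ideal.subspace_sum[OF is_ideal_irrelevant]) auto
  then show "p \<in> irrelevant_ideal" by (simp only: mpoly_sum_single)
qed

lemma mult_irrelevant_mem:
  assumes "is_ideal I" "\<And>x. var x * p \<in> I" "q \<in> irrelevant_ideal"
  shows "q * p \<in> I"
proof -
  have "q \<in> ideal_gen (range var)" using assms(3) by (simp add: irrelevant_ideal_def)
  then show ?thesis
  proof (induction rule: ideal.span_induct_alt)
    case base
    then show ?case using assms(1) by (simp add: ideal.subspace_0)
  next
    case (step c x y)
    then obtain v where v: "x = var v" by auto
    have "c * (var v * p) + y * p \<in> I"
      by (rule ideal.subspace_add[OF assms(1) ideal.subspace_scale[OF assms(1) assms(2)] step(2)])
    then show ?case by (simp only: v distrib_right mult.assoc)
  qed
qed

lemma var_irrelevant: "var x \<in> irrelevant_ideal"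
  by (simp add: irrelevant_ideal_def ideal.span_base)

lemma colon_irrelevant_iff:
  "is_ideal I \<Longrightarrow> p \<in> colon I irrelevant_ideal \<longleftrightarrow> (\<forall>x. var x * p \<in> I)"
  using mult_irrelevant_mem[of I p] var_irrelevant
  by (auto simp: colon_def mult.commute[of p])

definition hcomponent :: "int \<Rightarrow> ('v::finite, 'k::field) mpoly \<Rightarrow> ('v, 'k) mpoly" where
  "hcomponent t p = (\<Sum>m\<in>{m \<in> Poly_Mapping.keys p. int (mdeg m) = t}.
     Poly_Mapping.single m (Poly_Mapping.lookup p m))"

lemma lookup_hcomponent:
  "Poly_Mapping.lookup (hcomponent t p) m = (if int (mdeg m) = t then Poly_Mapping.lookup p m else 0)"
  by (auto simp: hcomponent_def lookup_sum lookup_single when_def in_keys_iff)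

lemma hom_of_degree_hcomponent: "hom_of_degree t (hcomponent t p)"
  by (auto simp: hom_of_degree_def in_keys_iff lookup_hcomponent split: if_splits)

lemma hcomponent_hom: "hom_of_degree d p \<Longrightarrow> hcomponent t p = (if t = d then p else 0)"
  by (rule poly_mapping_eqI) (force simp: hom_of_degree_def in_keys_iff lookup_hcomponent)

lemma hcomponent_0 [simp]: "hcomponent t 0 = 0"
  by (simp add: hcomponent_def)

lemma hcomponent_add: "hcomponent t (p + q) = hcomponent t p + hcomponent t q"
  by (rule poly_mapping_eqI) (simp add: lookup_hcomponent lookup_add)

lemma hcomponent_sum: "hcomponent t (sum f S) = (\<Sum>x\<in>S. hcomponent t (f x))"
  by (induction S rule: infinite_finite_induct) (auto simp: hcomponent_add)

lemma sum_hcomponent: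
  "p = (\<Sum>t\<in>(\<lambda>m. int (mdeg m)) ` Poly_Mapping.keys p. hcomponent t p)"
proof (rule poly_mapping_eqI)
  fix m
  show "Poly_Mapping.lookup p m = Poly_Mapping.lookup
      (\<Sum>t\<in>(\<lambda>m. int (mdeg m)) ` Poly_Mapping.keys p. hcomponent t p) m"
    by (cases "m \<in> Poly_Mapping.keys p") (auto simp: lookup_sum lookup_hcomponent in_keys_iff)
qed

text \<open>Integer degrees spare a side condition on \<open>t - d\<close>: components of negative
  degree are 0.\<close>

lemma hcomponent_mult_hom:
  assumes "hom_of_degree d a"
  shows "hcomponent t (a * p) = a * hcomponent (t - d) p"
proof -
  let ?S = "(\<lambda>m. int (mdeg m)) ` Poly_Mapping.keys p"
  have "hcomponent t (a * p) = (\<Sum>s\<in>?S. hcomponent t (a * hcomponent s p))"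
    by (subst (1) sum_hcomponent[of p]) (simp add: sum_distrib_left hcomponent_sum)
  also have "\<dots> = (\<Sum>s\<in>?S. if s = t - d then a * hcomponent s p else 0)"
    by (intro sum.cong)
      (auto simp: hcomponent_hom[OF hom_of_degree_mult[OF assms hom_of_degree_hcomponent]])
  also have "\<dots> = (if t - d \<in> ?S then a * hcomponent (t - d) p else 0)"
    by simp
  also have "\<dots> = a * hcomponent (t - d) p"
  proof -
    have "hcomponent (t - d) p = 0" if "t - d \<notin> ?S"
    proof (rule poly_mapping_eqI)
      fix m
      show "Poly_Mapping.lookup (hcomponent (t - d) p) m = Poly_Mapping.lookup 0 m"
        using that not_in_keys_iff_lookup_eq_zero[of m p] by (auto simp: lookup_hcomponent image_iff)
    qed
    then show ?thesis by simp
  qed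
  finally show ?thesis .
qed

lemma homogeneous_ideal_is_ideal: "homogeneous_ideal I \<Longrightarrow> is_ideal I"
  by (auto simp: homogeneous_ideal_def)

lemma homogeneous_ideal_hcomponent:
  assumes "homogeneous_ideal I" "p \<in> I"
  shows "hcomponent t p \<in> I"
proof -
  obtain S where S: "\<forall>s\<in>S. homogeneous s" "I = ideal_gen S"
    using assms(1) by (auto simp: homogeneous_ideal_def)
  have "p \<in> ideal_gen S" using assms(2) S by simp
  then show ?thesis unfolding S(2)
  proof (induction rule: ideal.span_induct_alt)
    case base
    then show ?case by (simp add: ideal.span_zero)
  next
    case (step c x y)
    then obtain d where d: "hom_of_degree d x" using S by (auto simp: homogeneous_def)
    have "hcomponent t (c * x + y) = hcomponent (t - d) c * x + hcomponent t y"
      using hcomponent_mult_hom[OF d, of t c] by (simp add: hcomponent_add mult.commute)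
    then show ?case using step by (simp add: ideal.span_add ideal.span_scale ideal.span_base)
  qed
qed

lemma homogeneous_ideal_memI:
  assumes "is_ideal I" "\<And>t. hcomponent t p \<in> I"
  shows "p \<in> I"
  by (subst sum_hcomponent) (simp add: assms ideal.subspace_sum)

text \<open>The matrix and the right-hand side are graded, so suitable homogeneous components of any
  solution again form a solution. This is how exactness, which is stated without degrees, yields
  degree-preserving lifts.\<close>

lemma hom_system_solve:
  assumes "finite T"
    and A: "\<And>i j. i \<in> S \<Longrightarrow> j \<in> T \<Longrightarrow> hom_of_degree (\<beta> j - \<alpha> i) (A i j)"
    and b: "\<And>i. i \<in> S \<Longrightarrow> hom_of_degree (t - \<alpha> i) (b i)"
    and v: "\<And>i. i \<in> S \<Longrightarrow> b i = (\<Sum>j\<in>T. A i j * v j)"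
  shows "\<exists>w. (\<forall>j\<in>T. hom_of_degree (t - \<beta> j) (w j)) \<and> (\<forall>i\<in>S. b i = (\<Sum>j\<in>T. A i j * w j))"
proof (intro exI conjI ballI)
  show "hom_of_degree (t - \<beta> j) (hcomponent (t - \<beta> j) (v j))" for j
    by (rule hom_of_degree_hcomponent)
  fix i assume i: "i \<in> S"
  have "b i = hcomponent (t - \<alpha> i) (b i)" using hcomponent_hom[OF b[OF i]] by simp
  also have "\<dots> = (\<Sum>j\<in>T. A i j * hcomponent (t - \<beta> j) (v j))"
    unfolding v[OF i] hcomponent_sum
    by (intro sum.cong refl) (simp add: hcomponent_mult_hom[OF A[OF i]])
  finally show "b i = (\<Sum>j\<in>T. A i j * hcomponent (t - \<beta> j) (v j))" .
qed

section \<open>Lifting between syzygy modules\<close>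

text \<open>Gaussian elimination: if the new equation involves an unknown \<open>s0\<close>, it is
  solved for \<open>s0\<close> and substituted into the others, at the cost of one equation and one
  unknown.\<close>

lemma underdetermined_system_solution:
  fixes A :: "'t \<Rightarrow> 's \<Rightarrow> 'k::field"
  assumes "finite T" "finite S" "card T < card S"
  shows "\<exists>v. (\<exists>s\<in>S. v s \<noteq> 0) \<and> (\<forall>t\<in>T. (\<Sum>s\<in>S. A t s * v s) = 0)"
  using assms
proof (induction T arbitrary: S A rule: finite_induct)
  case empty
  then obtain s where "s \<in> S" by fastforce
  then show ?case by (intro exI[of _ "\<lambda>_. 1"]) auto
next
  case (insert t T)
  show ?case
  proof (cases "\<forall>s\<in>S. A t s = 0")
    case True
    have "card T < card S" using insert by simp
    from insert.IH[OF insert.prems(1) this, of A] True show ?thesis by auto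
  next
    case False
    then obtain s0 where s0: "s0 \<in> S" "A t s0 \<noteq> 0" by blast
    let ?S = "S - {s0}"
    have "card T < card ?S" using insert s0 by simp
    then obtain v where v: "\<exists>s\<in>?S. v s \<noteq> 0"
      "\<forall>t'\<in>T. (\<Sum>s\<in>?S. (A t' s - A t' s0 * A t s / A t s0) * v s) = 0"
      using insert.IH[of ?S "\<lambda>t' s. A t' s - A t' s0 * A t s / A t s0"] insert.prems(1) by auto
    let ?w = "v(s0 := - (\<Sum>s\<in>?S. A t s * v s) / A t s0)"
    have split: "(\<Sum>s\<in>S. A t' s * ?w s) = A t' s0 * (- (\<Sum>s\<in>?S. A t s * v s) / A t s0) + (\<Sum>s\<in>?S. A t' s * v s)" for t'
      using insert.prems(1) s0(1) by (subst sum.remove[of _ s0]) auto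
    have "(\<Sum>s\<in>S. A t' s * ?w s) = 0" if "t' \<in> T" for t'
    proof -
      have "(\<Sum>s\<in>?S. (A t' s - A t' s0 * A t s / A t s0) * v s) =
          (\<Sum>s\<in>?S. A t' s * v s) - A t' s0 / A t s0 * (\<Sum>s\<in>?S. A t s * v s)"
        by (simp add: sum_subtractf sum_distrib_left left_diff_distrib mult.assoc)
      then show ?thesis using v(2) that unfolding split by simp
    qed
    moreover have "(\<Sum>s\<in>S. A t s * ?w s) = 0" using s0(2) unfolding split by simp
    moreover have "\<exists>s\<in>S. ?w s \<noteq> 0" using v(1) by auto
    ultimately show ?thesis by (intro exI[of _ ?w]) auto
  qed
qed

text \<open>The identity of k^S factors through k^T. If T were smaller, B would kill a nonzero
  vector, and so would the identity.\<close>

lemma card_le_of_left_inverse: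
  fixes A :: "'s \<Rightarrow> 't \<Rightarrow> 'k::field"
  assumes "finite S" "finite T"
    and AB: "\<And>s s'. s \<in> S \<Longrightarrow> s' \<in> S \<Longrightarrow> (\<Sum>t\<in>T. A s t * B t s') = (if s = s' then 1 else 0)"
  shows "card S \<le> card T"
proof (rule ccontr)
  assume "\<not> card S \<le> card T"
  then obtain v where v: "\<exists>s\<in>S. v s \<noteq> 0" "\<forall>t\<in>T. (\<Sum>s\<in>S. B t s * v s) = 0"
    using underdetermined_system_solution[of T S B] assms by auto
  have "v s = 0" if "s \<in> S" for s
  proof -
    have "v s = (\<Sum>s'\<in>S. (if s = s' then 1 else 0) * v s')"
      using that assms(1) by (simp add: if_distrib[of "\<lambda>a. a * _"] cong: if_cong)
    also have "\<dots> = (\<Sum>s'\<in>S. (\<Sum>t\<in>T. A s t * B t s') * v s')"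
      using AB that by simp
    also have "\<dots> = (\<Sum>t\<in>T. A s t * (\<Sum>s'\<in>S. B t s' * v s'))"
      by (simp add: sum_distrib_left sum_distrib_right mult.assoc sum.swap[of _ S T])
    finally show ?thesis using v(2) by simp
  qed
  then show False using v(1) by blast
qed

text \<open>Matrices are indexed here by arbitrary finite sets, which avoids renumbering the blocks of a
  block matrix.\<close>

definition mmul ::
    "'t set \<Rightarrow> ('s \<Rightarrow> 't \<Rightarrow> 'r::comm_ring_1) \<Rightarrow> ('t \<Rightarrow> 'u \<Rightarrow> 'r) \<Rightarrow> 's \<Rightarrow> 'u \<Rightarrow> 'r" where
  "mmul T A B = (\<lambda>i j. \<Sum>t\<in>T. A i t * B t j)"

definition idm :: "'s \<Rightarrow> 's \<Rightarrow> 'r::comm_ring_1" where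
  "idm = (\<lambda>i j. if i = j then 1 else 0)"

lemma mmul_assoc: "mmul T (mmul S A B) C = mmul S A (mmul T B C)"
  by (intro ext) (simp add: mmul_def sum_distrib_left sum_distrib_right mult.assoc sum.swap[of _ T S])

lemma mmul_cong_left: "(\<And>t. t \<in> T \<Longrightarrow> A i t = A' i t) \<Longrightarrow> mmul T A B i j = mmul T A' B i j"
  by (simp add: mmul_def)

lemma mmul_cong_right: "(\<And>t. t \<in> T \<Longrightarrow> B t j = B' t j) \<Longrightarrow> mmul T A B i j = mmul T A B' i j"
  by (simp add: mmul_def)

lemma mmul_idm_right: "finite T \<Longrightarrow> j \<in> T \<Longrightarrow> mmul T A idm i j = A i j"
  by (simp add: mmul_def idm_def if_distrib[of "\<lambda>a. _ * a"] cong: if_cong)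

lemma mmul_idm_left: "finite T \<Longrightarrow> i \<in> T \<Longrightarrow> mmul T idm A i j = A i j"
  by (simp add: mmul_def idm_def if_distrib[of "\<lambda>a. a * _"] cong: if_cong)

text \<open>The matrix of a degree-preserving map: columns index the source, whose basis degrees are
  \<tau>, and rows the target, whose basis degrees are \<sigma>.\<close>

definition hmat :: "'s set \<Rightarrow> 't set \<Rightarrow> ('s \<Rightarrow> int) \<Rightarrow> ('t \<Rightarrow> int) \<Rightarrow>
    ('s \<Rightarrow> 't \<Rightarrow> ('v::finite, 'k::field) mpoly) \<Rightarrow> bool" where
  "hmat S T \<sigma> \<tau> A \<longleftrightarrow> (\<forall>s\<in>S. \<forall>t\<in>T. hom_of_degree (\<tau> t - \<sigma> s) (A s t))"

lemma hmat_mmul: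
  assumes "hmat S T \<sigma> \<tau> A" "hmat T U \<tau> \<upsilon> B"
  shows "hmat S U \<sigma> \<upsilon> (mmul T A B)"
  unfolding hmat_def mmul_def
proof (intro ballI hom_of_degree_sum)
  fix s u t assume "s \<in> S" "u \<in> U" "t \<in> T"
  then show "hom_of_degree (\<upsilon> u - \<sigma> s) (A s t * B t u)"
    using hom_of_degree_mult[of "\<tau> t - \<sigma> s" "A s t" "\<upsilon> u - \<tau> t" "B t u"] assms
    by (simp add: hmat_def)
qed

text \<open>Projectivity of a graded free module, column by column: if each column of B is in the
  image of A, then B factors through A by a degree-preserving matrix.\<close>

lemma hmat_lift:
  assumes "finite T" "hmat S T \<sigma> \<tau> A" "hmat S U \<sigma> \<upsilon> B"
    and "\<And>u. u \<in> U \<Longrightarrow> \<exists>v. \<forall>s\<in>S. B s u = (\<Sum>t\<in>T. A s t * v t)"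
  obtains C where "hmat T U \<tau> \<upsilon> C" "\<And>s u. s \<in> S \<Longrightarrow> u \<in> U \<Longrightarrow> B s u = mmul T A C s u"
proof -
  have "\<forall>u\<in>U. \<exists>w. (\<forall>t\<in>T. hom_of_degree (\<upsilon> u - \<tau> t) (w t)) \<and> (\<forall>s\<in>S. B s u = (\<Sum>t\<in>T. A s t * w t))"
  proof
    fix u assume u: "u \<in> U"
    then obtain v where "\<forall>s\<in>S. B s u = (\<Sum>t\<in>T. A s t * v t)" using assms(4) by blast
    then show "\<exists>w. (\<forall>t\<in>T. hom_of_degree (\<upsilon> u - \<tau> t) (w t)) \<and> (\<forall>s\<in>S. B s u = (\<Sum>t\<in>T. A s t * w t))"
      using assms(2,3) u unfolding hmat_def by (intro hom_system_solve[OF assms(1), where v = v]) blast+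
  qed
  then obtain w where
    "\<forall>u\<in>U. (\<forall>t\<in>T. hom_of_degree (\<upsilon> u - \<tau> t) (w u t)) \<and> (\<forall>s\<in>S. B s u = (\<Sum>t\<in>T. A s t * w u t))"
    by (rule bchoice[THEN exE])
  then show ?thesis by (intro that[of "\<lambda>t u. w u t"]) (auto simp: hmat_def mmul_def)
qed

text \<open>The constant coefficients of a degree-preserving matrix vanish except between basis
  elements of equal degree. Modulo \<mm> the factorisation of the identity therefore splits into one
  factorisation over k for each degree.\<close>

lemma card_degree_le:
  fixes A :: "'s \<Rightarrow> 't \<Rightarrow> ('v::finite, 'k::field) mpoly"
  assumes fin: "finite S" "finite T"
    and A: "hmat S T \<sigma> \<tau> A" and B: "hmat T S \<tau> \<sigma> B"
    and AB: "\<And>s s'. s \<in> S \<Longrightarrow> s' \<in> S \<Longrightarrow> mmul T A B s s' - idm s s' \<in> irrelevant_ideal"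
  shows "card {s \<in> S. \<sigma> s = n} \<le> card {t \<in> T. \<tau> t = n}"
proof (rule card_le_of_left_inverse)
  let ?A = "\<lambda>s t. Poly_Mapping.lookup (A s t) 0" and ?B = "\<lambda>t s. Poly_Mapping.lookup (B t s) 0"
  fix s s' assume s: "s \<in> {s \<in> S. \<sigma> s = n}" "s' \<in> {s \<in> S. \<sigma> s = n}"
  have A0: "?A s t = 0" if "t \<in> T" "\<tau> t \<noteq> n" for t
  proof (rule ccontr)
    assume "?A s t \<noteq> 0"
    moreover have "hom_of_degree (\<tau> t - n) (A s t)" using A s(1) that(1) by (auto simp: hmat_def)
    ultimately show False using hom_of_degree_lookup_0 that(2) by fastforce
  qed
  have "(\<Sum>t\<in>{t \<in> T. \<tau> t = n}. ?A s t * ?B t s') = (\<Sum>t\<in>T. ?A s t * ?B t s')"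
    using fin(2) A0 by (intro sum.mono_neutral_left) auto
  also have "\<dots> = Poly_Mapping.lookup (mmul T A B s s') 0"
    by (simp add: mmul_def lookup_sum lookup_mult_0)
  also have "\<dots> = Poly_Mapping.lookup (idm s s' :: ('v, 'k) mpoly) 0"
    using AB[of s s'] s by (simp add: irrelevant_ideal_iff lookup_minus)
  also have "\<dots> = (if s = s' then 1 else 0)" by (simp add: idm_def lookup_one)
  finally show "(\<Sum>t\<in>{t \<in> T. \<tau> t = n}. ?A s t * ?B t s') = (if s = s' then 1 else 0)" .
qed (use fin in auto)

text \<open>\<open>X\<close> and \<open>Y\<close> generate the syzygies of the generating sets \<open>q\<close> and \<open>y\<close> of one module. Since
  \<open>P' P - 1\<close> maps into the syzygies of \<open>q\<close> and \<open>X\<close> has entries in \<open>\<mm>\<close>, the lifts \<open>C\<close> and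
  \<open>C'\<close> of \<open>P'\<close> and \<open>P\<close> are inverse to each other modulo \<open>\<mm>\<close> and the kernel of \<open>X\<close>.\<close>

lemma syzygy_lift_inverse:
  fixes q :: "'r \<Rightarrow> 'a \<Rightarrow> ('v::finite, 'k::field) mpoly"
  assumes fin: "finite A" "finite B"
    and syz: "\<And>v. (\<forall>r\<in>R. (\<Sum>a\<in>A. q r a * v a) = 0) \<Longrightarrow> \<exists>w. \<forall>a\<in>A. v a = (\<Sum>b\<in>B. X a b * w b)"
    and X: "\<And>a b. a \<in> A \<Longrightarrow> b \<in> B \<Longrightarrow> X a b \<in> irrelevant_ideal"
    and q: "\<And>r a. r \<in> R \<Longrightarrow> a \<in> A \<Longrightarrow> q r a = mmul C y P r a"
    and y: "\<And>r c. r \<in> R \<Longrightarrow> c \<in> C \<Longrightarrow> y r c = mmul A q P' r c"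
    and PX: "\<And>c b. c \<in> C \<Longrightarrow> b \<in> B \<Longrightarrow> mmul A P X c b = mmul E Y M' c b"
    and P'Y: "\<And>a e. a \<in> A \<Longrightarrow> e \<in> E \<Longrightarrow> mmul C P' Y a e = mmul B X M a e"
    and b: "b \<in> B"
  shows "\<exists>w. (\<forall>b'\<in>B. w b' \<in> irrelevant_ideal) \<and>
    (\<forall>a\<in>A. (\<Sum>b'\<in>B. X a b' * (mmul E M M' b' b - idm b' b - w b')) = 0)"
proof -
  have "\<forall>a'\<in>A. \<exists>w. \<forall>a\<in>A. mmul C P' P a a' - idm a a' = (\<Sum>b\<in>B. X a b * w b)"
  proof (intro ballI syz)
    fix a' r assume a': "a' \<in> A" and r: "r \<in> R"
    have "(\<Sum>a\<in>A. q r a * (mmul C P' P a a' - idm a a')) =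
        mmul A q (mmul C P' P) r a' - mmul A q idm r a'"
      by (simp add: mmul_def sum_subtractf right_diff_distrib)
    also have "mmul A q (mmul C P' P) r a' = mmul C (mmul A q P') P r a'"
      by (simp add: mmul_assoc)
    also have "\<dots> = mmul C y P r a'" using y r by (intro mmul_cong_left) simp
    finally show "(\<Sum>a\<in>A. q r a * (mmul C P' P a a' - idm a a')) = 0"
      using q[OF r a'] mmul_idm_right[OF fin(1) a', of q r] by simp
  qed
  then obtain N where N: "\<forall>a'\<in>A. \<forall>a\<in>A. mmul C P' P a a' - idm a a' = (\<Sum>b\<in>B. X a b * N a' b)"
    by (rule bchoice[THEN exE])
  \<comment> \<open>Since X (M M' - 1) = (P' P - 1) X = X N X, the correction is N X, and it has
    entries in \<mm> because X has.\<close>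
  define w where "w b' = (\<Sum>a\<in>A. N a b' * X a b)" for b'
  have "w b' \<in> irrelevant_ideal" for b'
    unfolding w_def
    by (intro ideal.subspace_sum[OF is_ideal_irrelevant] is_ideal_mult_left[OF is_ideal_irrelevant] X b)
  moreover have "(\<Sum>b'\<in>B. X a b' * (mmul E M M' b' b - idm b' b - w b')) = 0" if a: "a \<in> A" for a
  proof -
    have "mmul B X (mmul E M M') a b = mmul E (mmul B X M) M' a b" by (simp add: mmul_assoc)
    also have "\<dots> = mmul E (mmul C P' Y) M' a b"
      using P'Y a by (intro mmul_cong_left) simp
    also have "\<dots> = mmul C P' (mmul E Y M') a b" by (simp add: mmul_assoc)
    also have "\<dots> = mmul C P' (mmul A P X) a b" using PX b by (intro mmul_cong_right) simp
    also have "\<dots> = mmul A (mmul C P' P) X a b" by (simp add: mmul_assoc)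
    also have "\<dots> = mmul A (\<lambda>a a'. idm a a' + (\<Sum>b\<in>B. X a b * N a' b)) X a b"
      using N a by (intro mmul_cong_left) (simp flip: diff_eq_eq add: add.commute[of "idm _ _"])
    also have "\<dots> = mmul A idm X a b + (\<Sum>a'\<in>A. (\<Sum>b\<in>B. X a b * N a' b) * X a' b)"
      by (simp add: mmul_def distrib_right sum.distrib)
    also have "mmul A idm X a b = X a b" using fin(1) a by (rule mmul_idm_left)
    also have "(\<Sum>a'\<in>A. (\<Sum>b\<in>B. X a b * N a' b) * X a' b) = (\<Sum>b'\<in>B. X a b' * w b')"
      by (simp add: w_def sum_distrib_left sum_distrib_right mult.assoc sum.swap[of _ A B])
    finally have "mmul B X (mmul E M M') a b - mmul B X idm a b - (\<Sum>b'\<in>B. X a b' * w b') = 0"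
      using mmul_idm_right[OF fin(2) b, of X a] by simp
    then show ?thesis by (simp add: mmul_def sum_subtractf right_diff_distrib)
  qed
  ultimately show ?thesis by blast
qed

section \<open>Exactness of the Koszul complex\<close>

text \<open>The variables carry no order of their own; \<open>to_nat\<close> supplies the linear
  order on which Koszul signs depend.\<close>

definition ksign :: "'v::finite \<Rightarrow> 'v set \<Rightarrow> 'k::field" where
  "ksign x S = (- 1) ^ card {y \<in> S. to_nat y < to_nat x}"

text \<open>A family \<open>w\<close> stands for the element \<Sum> w_S e_S of the Koszul complex on
  the variables, all exterior degrees at once; the value at \<open>S\<close> is the coefficient of
  e_S in its boundary.\<close>

definition kdiff :: "('v::finite set \<Rightarrow> ('v, 'k::field) mpoly) \<Rightarrow> 'v set \<Rightarrow> ('v, 'k) mpoly" where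
  "kdiff w S = (\<Sum>x\<in>-S. const (ksign x S) * (var x * w (insert x S)))"

lemma to_nat_less_cases:
  fixes x y :: "'v::countable"
  assumes "x \<noteq> y"
  obtains "to_nat x < to_nat y" | "to_nat y < to_nat x"
  using assms inj_to_nat[where 'a = 'v] by (metis injD linorder_neqE_nat)

lemma ksign_insert_greater:
  assumes "x \<notin> S" "to_nat x < to_nat y"
  shows "ksign y (insert x S) = - ksign y S"
proof -
  have "{z \<in> insert x S. to_nat z < to_nat y} = insert x {z \<in> S. to_nat z < to_nat y}"
    using assms by auto
  then show ?thesis using assms by (simp add: ksign_def)
qed

lemma ksign_insert_less:
  assumes "to_nat x < to_nat y"
  shows "ksign x (insert y S) = ksign x S"
proof -
  have "{z \<in> insert y S. to_nat z < to_nat x} = {z \<in> S. to_nat z < to_nat x}"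
    using assms by auto
  then show ?thesis by (simp add: ksign_def)
qed

lemma const_uminus: "const (- a) = - const a"
  by (simp add: const_def single_uminus)

text \<open>The terms that remove x and y in the two possible orders cancel: inserting the smaller
  variable flips the sign of the larger one, but not conversely.\<close>

lemma kdiff_kdiff:
  fixes w :: "'v::finite set \<Rightarrow> ('v, 'k::field) mpoly"
  shows "kdiff (kdiff w) S = 0"
proof -
  let ?g = "\<lambda>(x, y). const (ksign x S) * (var x * (const (ksign y (insert x S)) *
    (var y * w (insert y (insert x S)))))"
  let ?T = "SIGMA x:-S. - insert x S"
  let ?L = "{(x, y) \<in> ?T. to_nat x < to_nat y}" and ?U = "{(x, y) \<in> ?T. to_nat y < to_nat x}"
  have "kdiff (kdiff w) S = sum ?g ?T"
    by (simp add: kdiff_def sum_distrib_left sum.Sigma)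
  also have "?T = ?L \<union> ?U" by (auto elim: to_nat_less_cases)
  also have "sum ?g (?L \<union> ?U) = sum ?g ?L + sum ?g ?U"
    by (rule sum.union_disjoint) auto
  also have "sum ?g ?U = sum (?g \<circ> prod.swap) ?L"
  proof -
    have "?U = prod.swap ` ?L" by (auto simp: image_iff)
    then show ?thesis by (simp add: sum.reindex)
  qed
  also have "\<dots> = - sum ?g ?L"
    unfolding sum_negf[symmetric]
  proof (rule sum.cong[OF refl])
    fix z assume z: "z \<in> ?L"
    then obtain x y where xy: "z = (x, y)" "x \<notin> S" "y \<notin> S" "to_nat x < to_nat y" by auto
    show "(?g \<circ> prod.swap) z = - ?g z"
      using ksign_insert_greater[OF xy(2,4), where 'b = 'k] ksign_insert_less[OF xy(4), of S, where 'b = 'k]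
      by (simp add: xy(1) const_uminus insert_commute mult.left_commute)
  qed
  finally show ?thesis by simp
qed

lemma kdiff_cong: "(\<And>x. x \<notin> S \<Longrightarrow> w (insert x S) = w' (insert x S)) \<Longrightarrow> kdiff w S = kdiff w' S"
  by (simp add: kdiff_def)

lemma kdiff_diff: "kdiff (\<lambda>S. w S - w' S) S = kdiff w S - kdiff w' S"
  by (simp add: kdiff_def right_diff_distrib sum_subtractf)

lemma kdiff_sum: "kdiff (\<lambda>S. \<Sum>b\<in>B. f b * w b S) S = (\<Sum>b\<in>B. f b * kdiff (w b) S)"
  by (simp add: kdiff_def sum_distrib_left mult.left_commute sum.swap[of _ "- S" B])

lemma kdiff_irrelevant: "kdiff w S \<in> irrelevant_ideal"
  unfolding kdiff_def
  by (intro ideal.subspace_sum[OF is_ideal_irrelevant] is_ideal_mult_left[OF is_ideal_irrelevant]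
      is_ideal_mult_right[OF is_ideal_irrelevant] var_irrelevant)

lemma lookup_var_mult:
  fixes p :: "('v::finite, 'k::field) mpoly"
  shows "Poly_Mapping.lookup (var x * p) a =
    (if Poly_Mapping.lookup a x \<noteq> 0 then Poly_Mapping.lookup p (a - Poly_Mapping.single x 1) else 0)"
proof -
  let ?e = "Poly_Mapping.single x (1::nat)"
  have "Poly_Mapping.keys (var x :: ('v, 'k) mpoly) = {?e}" by (simp add: var_def)
  then have "var x * p = (\<Sum>m\<in>Poly_Mapping.keys p. Poly_Mapping.single (?e + m) (Poly_Mapping.lookup p m))"
    by (subst mpoly_mult_expand) (simp add: var_def)
  then have *: "Poly_Mapping.lookup (var x * p) a =
      (\<Sum>m\<in>Poly_Mapping.keys p. if ?e + m = a then Poly_Mapping.lookup p m else 0)"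
    by (simp add: lookup_sum lookup_single when_def)
  show ?thesis
  proof (cases "Poly_Mapping.lookup a x = 0")
    case True
    then have "?e + m \<noteq> a" for m by (auto simp: lookup_add)
    then show ?thesis using True * by simp
  next
    case False
    then have "?e + m = a \<longleftrightarrow> m = a - ?e" for m
      by (auto simp: poly_mapping_eq_iff fun_eq_iff lookup_add lookup_minus lookup_single when_def)
    then show ?thesis using False * by (auto simp: in_keys_iff)
  qed
qed

lemma lookup_kdiff:
  "Poly_Mapping.lookup (kdiff w S) a = (\<Sum>x\<in>-S. if Poly_Mapping.lookup a x \<noteq> 0
     then ksign x S * Poly_Mapping.lookup (w (insert x S)) (a - Poly_Mapping.single x 1) else 0)"
  by (auto simp: kdiff_def lookup_sum lookup_var_mult intro!: sum.cong)

definition first_var :: "'v::finite set \<Rightarrow> 'v" where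
  "first_var S = arg_min to_nat (\<lambda>x. x \<in> S)"

lemma first_var_in: "S \<noteq> {} \<Longrightarrow> first_var S \<in> S"
  and first_var_le: "y \<in> S \<Longrightarrow> to_nat (first_var S) \<le> to_nat y"
  unfolding first_var_def using arg_min_nat_lemma[of "\<lambda>x. x \<in> S" _ to_nat] by auto

lemma first_var_eqI:
  fixes x :: "'v::finite"
  assumes "x \<in> S" "\<And>y. y \<in> S \<Longrightarrow> to_nat x \<le> to_nat y"
  shows "first_var S = x"
proof -
  have "to_nat (first_var S) = to_nat x"
    using assms(2)[OF first_var_in] first_var_le[OF assms(1)] assms(1) by (intro antisym) auto
  then show ?thesis by simp
qed

text \<open>The contracting homotopy sends \<open>x\<^sup>a e\<^sub>S\<close> to \<open>(x\<^sup>a / x\<^sub>i) e\<^bsub>S \<union> {i}\<^esub>\<close> when the smallest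
  variable \<open>i\<close> occurring in \<open>x\<^sup>a e\<^sub>S\<close> is not in \<open>S\<close>, and to \<open>0\<close> otherwise.\<close>

definition khomotopy ::
    "('v::finite set \<Rightarrow> ('v, 'k::field) mpoly) \<Rightarrow> 'v set \<Rightarrow> ('v, 'k) mpoly" where
  "khomotopy w S = Abs_poly_mapping (\<lambda>b.
     if S \<noteq> {} \<and> (\<forall>y\<in>Poly_Mapping.keys b. to_nat (first_var S) \<le> to_nat y)
     then Poly_Mapping.lookup (w (S - {first_var S})) (b + Poly_Mapping.single (first_var S) 1) else 0)"

lemma lookup_khomotopy:
  "Poly_Mapping.lookup (khomotopy w S) b =
     (if S \<noteq> {} \<and> (\<forall>y\<in>Poly_Mapping.keys b. to_nat (first_var S) \<le> to_nat y)
     then Poly_Mapping.lookup (w (S - {first_var S})) (b + Poly_Mapping.single (first_var S) 1) else 0)"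
proof -
  let ?f = "\<lambda>b. if S \<noteq> {} \<and> (\<forall>y\<in>Poly_Mapping.keys b. to_nat (first_var S) \<le> to_nat y)
     then Poly_Mapping.lookup (w (S - {first_var S})) (b + Poly_Mapping.single (first_var S) 1) else 0"
  have "{b. ?f b \<noteq> 0} \<subseteq> (\<lambda>m. m - Poly_Mapping.single (first_var S) 1) `
      Poly_Mapping.keys (w (S - {first_var S}))"
  proof
    fix b assume "b \<in> {b. ?f b \<noteq> 0}"
    then have "b + Poly_Mapping.single (first_var S) 1 \<in> Poly_Mapping.keys (w (S - {first_var S}))"
      by (auto simp: in_keys_iff split: if_splits)
    then show "b \<in> (\<lambda>m. m - Poly_Mapping.single (first_var S) 1) `
        Poly_Mapping.keys (w (S - {first_var S}))"
      by (rule rev_image_eqI) simp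
  qed
  then have "finite {b. ?f b \<noteq> 0}" by (rule finite_subset) simp
  then show ?thesis unfolding khomotopy_def by (subst lookup_Abs_poly_mapping) auto
qed

text \<open>With e_S placed in degree \<open>card S\<close>, the hypothesis says that
  \<open>w\<close> is homogeneous of degree \<open>s\<close>. The homotopy trades a factor x_i for
  e_i and so keeps this degree.\<close>

lemma hom_of_degree_khomotopy:
  assumes "\<And>S. hom_of_degree (s - int (card S)) (w S)"
  shows "hom_of_degree (s - int (card S)) (khomotopy w S)"
  unfolding hom_of_degree_def
proof
  fix b assume "b \<in> Poly_Mapping.keys (khomotopy w S)"
  then have S: "S \<noteq> {}" and b: "b + Poly_Mapping.single (first_var S) 1 \<in> Poly_Mapping.keys (w (S - {first_var S}))"
    by (auto simp: in_keys_iff lookup_khomotopy split: if_splits)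
  have "int (mdeg (b + Poly_Mapping.single (first_var S) 1)) = s - int (card (S - {first_var S}))"
    using assms[of "S - {first_var S}"] b by (auto simp: hom_of_degree_def)
  moreover have "int (card (S - {first_var S})) = int (card S) - 1"
    using S first_var_in[OF S] by (simp add: card_Diff_singleton of_nat_diff card_gt_0_iff Suc_le_eq)
  ultimately show "int (mdeg b) = s - int (card S)" by (simp add: mdeg_add)
qed

lemma ksign_first: "(\<And>y. y \<in> S \<Longrightarrow> to_nat x \<le> to_nat y) \<Longrightarrow> ksign x S = 1"
proof -
  assume "\<And>y. y \<in> S \<Longrightarrow> to_nat x \<le> to_nat y"
  then have "{y \<in> S. to_nat y < to_nat x} = {}" by fastforce
  then show ?thesis by (simp only: ksign_def card.empty power_0)
qed

text \<open>Everything depends on the smallest variable \<open>i\<close> of x^a e_S. If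
  \<open>i\<close> is in \<open>S\<close>, the term of index \<open>i\<close> in the homotopy of the
  boundary gives back the coefficient of \<open>w\<close>, and the other terms cancel against the
  boundary of the homotopy. If not, the homotopy of the boundary vanishes, and only the term of
  index \<open>i\<close> survives in the boundary of the homotopy.\<close>

lemma khomotopy_contracting:
  fixes w :: "'v::finite set \<Rightarrow> ('v, 'k::field) mpoly"
  assumes "S \<noteq> {} \<or> a \<noteq> 0"
  shows "Poly_Mapping.lookup (kdiff (khomotopy w) S) a + Poly_Mapping.lookup (khomotopy (kdiff w) S) a =
    Poly_Mapping.lookup (w S) a"
proof -
  define i where "i = first_var (S \<union> Poly_Mapping.keys a)"
  let ?e = "\<lambda>x. Poly_Mapping.single x (1::nat)"
  have "S \<union> Poly_Mapping.keys a \<noteq> {}" using assms by auto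
  then have i: "i \<in> S \<union> Poly_Mapping.keys a" unfolding i_def by (rule first_var_in)
  have i_le: "to_nat i \<le> to_nat y" if "y \<in> S \<union> Poly_Mapping.keys a" for y
    unfolding i_def using that by (rule first_var_le)
  have keys_diff: "Poly_Mapping.keys (a - ?e x) \<subseteq> Poly_Mapping.keys a" for x
    by (auto simp: in_keys_iff lookup_minus)
  show ?thesis
  proof (cases "i \<in> S")
    case True
    have fS: "first_var S = i" using True i_le by (intro first_var_eqI) auto
    let ?h = "\<lambda>x. if Poly_Mapping.lookup a x \<noteq> 0
      then ksign x S * Poly_Mapping.lookup (w (insert x (S - {i}))) (a + ?e i - ?e x) else 0"
    have "Poly_Mapping.lookup (khomotopy (kdiff w) S) a =
        Poly_Mapping.lookup (kdiff w (S - {i})) (a + ?e i)"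
      using True i_le by (auto simp: lookup_khomotopy fS)
    also have "\<dots> = (\<Sum>x\<in>insert i (- S). if Poly_Mapping.lookup (a + ?e i) x \<noteq> 0
        then ksign x (S - {i}) * Poly_Mapping.lookup (w (insert x (S - {i}))) (a + ?e i - ?e x) else 0)"
    proof -
      have "- (S - {i}) = insert i (- S)" by auto
      then show ?thesis by (simp only: lookup_kdiff)
    qed
    also have "\<dots> = Poly_Mapping.lookup (w S) a + (\<Sum>x\<in>-S. - ?h x)"
    proof -
      have "ksign i (S - {i}) = (1::'k)" using i_le by (intro ksign_first) auto
      moreover have "(\<Sum>x\<in>-S. if Poly_Mapping.lookup (a + ?e i) x \<noteq> 0
        then ksign x (S - {i}) * Poly_Mapping.lookup (w (insert x (S - {i}))) (a + ?e i - ?e x) else 0) =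
        (\<Sum>x\<in>-S. - ?h x)"
      proof (rule sum.cong[OF refl])
        fix x assume x: "x \<in> - S"
        then have "x \<noteq> i" using True by auto
        moreover have "ksign x S = - (ksign x (S - {i}) :: 'k)" if "Poly_Mapping.lookup a x \<noteq> 0"
        proof -
          have "to_nat i \<le> to_nat x" using that by (intro i_le) (simp add: in_keys_iff)
          then have "to_nat i < to_nat x" using \<open>x \<noteq> i\<close> by (auto elim: to_nat_less_cases)
          then show ?thesis using ksign_insert_greater[of i "S - {i}" x, where 'b = 'k] True
            by (simp add: insert_absorb)
        qed
        ultimately show "(if Poly_Mapping.lookup (a + ?e i) x \<noteq> 0
          then ksign x (S - {i}) * Poly_Mapping.lookup (w (insert x (S - {i}))) (a + ?e i - ?e x) else 0) = - ?h x"
          by (simp add: lookup_add lookup_single when_def)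
      qed
      ultimately show ?thesis
        using True by (simp add: lookup_add insert_absorb)
    qed
    finally have 1: "Poly_Mapping.lookup (khomotopy (kdiff w) S) a =
        Poly_Mapping.lookup (w S) a + (\<Sum>x\<in>-S. - ?h x)" .
    have "Poly_Mapping.lookup (kdiff (khomotopy w) S) a = (\<Sum>x\<in>-S. ?h x)"
      unfolding lookup_kdiff
    proof (intro sum.cong refl if_cong arg_cong[of _ _ "(*) (ksign _ S)"])
      fix x assume x: "x \<in> - S" "Poly_Mapping.lookup a x \<noteq> 0"
      then have "x \<in> Poly_Mapping.keys a" by (simp add: in_keys_iff)
      then have f: "first_var (insert x S) = i" using True i_le by (intro first_var_eqI) auto
      have "insert x S - {i} = insert x (S - {i})" using True x(1) by auto
      moreover have "a - ?e x + ?e i = a + ?e i - ?e x"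
        using x(2) by (intro poly_mapping_eqI) (auto simp: lookup_add lookup_minus lookup_single when_def)
      ultimately show "Poly_Mapping.lookup (khomotopy w (insert x S)) (a - ?e x) =
          Poly_Mapping.lookup (w (insert x (S - {i}))) (a + ?e i - ?e x)"
        using keys_diff[of x] i_le by (auto simp: lookup_khomotopy f)
    qed
    then show ?thesis using 1 by (simp add: sum_negf)
  next
    case False
    then have ia: "i \<in> Poly_Mapping.keys a" using i by auto
    have lt: "to_nat i < to_nat x" if "x \<in> S" for x
    proof -
      have "x \<noteq> i" using that False by auto
      then show ?thesis using i_le[of x] that by (auto elim: to_nat_less_cases)
    qed
    have "Poly_Mapping.lookup (khomotopy (kdiff w) S) a = 0"
      using lt[OF first_var_in[of S]] ia by (force simp: lookup_khomotopy)
    moreover have "Poly_Mapping.lookup (kdiff (khomotopy w) S) a =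
        (\<Sum>x\<in>-S. if x = i then Poly_Mapping.lookup (w S) a else 0)"
      unfolding lookup_kdiff
    proof (rule sum.cong[OF refl])
      fix x assume x: "x \<in> - S"
      show "(if Poly_Mapping.lookup a x \<noteq> 0 then ksign x S *
          Poly_Mapping.lookup (khomotopy w (insert x S)) (a - ?e x) else 0) =
        (if x = i then Poly_Mapping.lookup (w S) a else 0)"
      proof (cases "x = i")
        case True
        have "first_var (insert i S) = i" using lt by (intro first_var_eqI) (auto intro: less_imp_le)
        moreover have "ksign i S = (1::'k)" using lt by (intro ksign_first) (auto intro: less_imp_le)
        moreover have "a - ?e i + ?e i = a"
          using ia by (intro poly_mapping_eqI) (auto simp: in_keys_iff lookup_add lookup_minus lookup_single when_def)
        moreover have "insert i S - {i} = S" using False by auto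
        ultimately show ?thesis
          using True ia keys_diff[of i] i_le by (auto simp: lookup_khomotopy in_keys_iff)
      next
        case neq: False
        have "Poly_Mapping.lookup (khomotopy w (insert x S)) (a - ?e x) = 0"
          if ax: "Poly_Mapping.lookup a x \<noteq> 0"
        proof -
          have "i \<in> Poly_Mapping.keys (a - ?e x)"
            using ia neq by (simp add: in_keys_iff lookup_minus lookup_single when_def)
          moreover have "to_nat i < to_nat (first_var (insert x S))"
          proof -
            have "to_nat i < to_nat x"
              using i_le[of x] ax neq by (auto simp: in_keys_iff elim: to_nat_less_cases)
            then show ?thesis using first_var_in[of "insert x S"] lt by auto
          qed
          ultimately show ?thesis by (force simp: lookup_khomotopy)
        qed
        then show ?thesis using neq by simp
      qed
    qed
    moreover have "(\<Sum>x\<in>-S. if x = i then Poly_Mapping.lookup (w S) a else 0) = Poly_Mapping.lookup (w S) a"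
      using False by simp
    ultimately show ?thesis by simp
  qed
qed

text \<open>The homotopy formula fails only for the constant coefficient at the empty set.
  Boundaries have none there, whence the condition on \<open>w {}\<close>.\<close>

lemma koszul_exact:
  assumes "\<And>S. kdiff w S = 0" "w {} \<in> irrelevant_ideal"
  shows "kdiff (khomotopy w) S = w S"
proof (rule poly_mapping_eqI)
  fix a
  have "kdiff w = (\<lambda>S. 0)" using assms(1) by auto
  then have h0: "Poly_Mapping.lookup (khomotopy (kdiff w) S) a = 0" by (simp add: lookup_khomotopy)
  show "Poly_Mapping.lookup (kdiff (khomotopy w) S) a = Poly_Mapping.lookup (w S) a"
  proof (cases "S = {} \<and> a = 0")
    case True
    then show ?thesis using assms(2) kdiff_irrelevant[of "khomotopy w" "{}"]
      by (simp add: irrelevant_ideal_iff)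
  next
    case False
    then show ?thesis using khomotopy_contracting[of S a w] h0 by auto
  qed
qed

section \<open>Socle elements from the last syzygies\<close>

text \<open>A minimal resolution in coordinates: \<open>r i\<close> is the rank of \<open>F\<^sub>i\<close>, \<open>e i\<close> lists the degrees of its
  basis, and \<open>D i\<close> is the matrix of \<open>F\<^sub>i \<rightarrow> F\<^bsub>i-1\<^esub>\<close>.\<close>

locale resolution =
  fixes c :: nat and I :: "('v::finite, 'k::field) mpoly set"
    and r :: "nat \<Rightarrow> nat" and e :: "nat \<Rightarrow> nat \<Rightarrow> int"
    and D :: "nat \<Rightarrow> nat \<Rightarrow> nat \<Rightarrow> ('v, 'k) mpoly"
  assumes r_0: "r 0 = 1" and e_0: "e 0 0 = 0"
    and hom: "i < c \<Longrightarrow> a < r i \<Longrightarrow> b < r (Suc i) \<Longrightarrow>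
      hom_of_degree (e (Suc i) b - e i a) (D (Suc i) a b)"
    and irr: "i < c \<Longrightarrow> a < r i \<Longrightarrow> b < r (Suc i) \<Longrightarrow> D (Suc i) a b \<in> irrelevant_ideal"
    and mem_iff: "p \<in> I \<longleftrightarrow> (\<exists>v. p = (\<Sum>b<r 1. D 1 0 b * v b))"
    and exact: "Suc i < c \<Longrightarrow>
      (\<forall>a<r i. (\<Sum>b<r (Suc i). D (Suc i) a b * v b) = 0) \<longleftrightarrow>
      (\<exists>w. \<forall>b<r (Suc i). v b = (\<Sum>l<r (Suc (Suc i)). D (Suc (Suc i)) b l * w l))"
    and inj: "Suc i = c \<Longrightarrow> (\<forall>a<r i. (\<Sum>b<r (Suc i). D (Suc i) a b * v b) = 0) \<Longrightarrow>
      b < r (Suc i) \<Longrightarrow> v b = 0"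
begin

lemma composition_0:
  assumes "Suc i < c" "a < r i" "l < r (Suc (Suc i))"
  shows "(\<Sum>b<r (Suc i). D (Suc i) a b * D (Suc (Suc i)) b l) = 0"
proof -
  have "\<forall>b<r (Suc i). D (Suc (Suc i)) b l =
      (\<Sum>l'<r (Suc (Suc i)). D (Suc (Suc i)) b l' * (if l' = l then 1 else 0))"
    using assms(3) by (simp add: if_distrib[of "\<lambda>a. _ * a"] cong: if_cong)
  then have "\<forall>a<r i. (\<Sum>b<r (Suc i). D (Suc i) a b * D (Suc (Suc i)) b l) = 0"
    unfolding exact[OF assms(1)] by (intro exI[of _ "\<lambda>l'. if l' = l then 1 else 0"])
  then show ?thesis using assms(2) by simp
qed

text \<open>Such a cycle is a boundary, and the entries of the next differential lie in \<mm>. The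
  strict inequality provides that next differential.\<close>

lemma kernel_irrelevant:
  assumes "Suc i < c" "\<forall>a<r i. (\<Sum>b<r (Suc i). D (Suc i) a b * v b) = 0" "b < r (Suc i)"
  shows "v b \<in> irrelevant_ideal"
proof -
  obtain w where "v b = (\<Sum>l<r (Suc (Suc i)). D (Suc (Suc i)) b l * w l)"
    using exact[OF assms(1)] assms(2,3) by blast
  then show ?thesis
    using assms(1,3) by (auto intro!: ideal.subspace_sum[OF is_ideal_irrelevant]
        is_ideal_mult_right[OF is_ideal_irrelevant] irr)
qed

lemma is_ideal: "is_ideal I"
proof (rule ideal.subspaceI)
  show "0 \<in> I" unfolding mem_iff by (intro exI[of _ "\<lambda>_. 0"]) simp
  fix x y assume "x \<in> I" "y \<in> I"
  then obtain v w where "x = (\<Sum>b<r 1. D 1 0 b * v b)" "y = (\<Sum>b<r 1. D 1 0 b * w b)"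
    unfolding mem_iff by (elim exE)
  then have "x + y = (\<Sum>b<r 1. D 1 0 b * (v b + w b))" by (simp add: distrib_left sum.distrib)
  then show "x + y \<in> I" unfolding mem_iff by (intro exI[of _ "\<lambda>b. v b + w b"])
next
  fix q x assume "x \<in> I"
  then obtain v where "x = (\<Sum>b<r 1. D 1 0 b * v b)" unfolding mem_iff by (rule exE)
  then have "q * x = (\<Sum>b<r 1. D 1 0 b * (q * v b))" by (simp add: sum_distrib_left mult.left_commute)
  then show "q * x \<in> I" unfolding mem_iff by (intro exI[of _ "\<lambda>b. q * v b"])
qed

lemma generator_mem: "b < r 1 \<Longrightarrow> D 1 0 b \<in> I"
  unfolding mem_iff by (intro exI[of _ "\<lambda>b'. if b' = b then 1 else 0"])
    (simp add: if_distrib[of "\<lambda>a. _ * a"] cong: if_cong)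

text \<open>A zigzag in the double complex \<open>F\<^sub>\<bullet> \<otimes> K\<^sub>\<bullet>\<close> with the Koszul complex leads from \<open>F\<^sub>c \<otimes> K\<^sub>0\<close> to
  \<open>F\<^sub>0 \<otimes> K\<^sub>c\<close>.\<close>

definition zigzag :: "(nat \<Rightarrow> ('v, 'k) mpoly) \<Rightarrow> (nat \<Rightarrow> nat \<Rightarrow> 'v set \<Rightarrow> ('v, 'k) mpoly) \<Rightarrow> bool" where
  "zigzag u W \<longleftrightarrow> (\<forall>b<r c. W c b {} = u b) \<and>
     (\<forall>i<c. \<forall>a<r i. \<forall>S. kdiff (W i a) S = (\<Sum>b<r (Suc i). D (Suc i) a b * W (Suc i) b S))"

text \<open>Recursion on the number \<open>n\<close> of steps taken down from F_c:
  \<open>chase u n\<close> has its coefficients in F_{c-n}. The start lies in F_c \<otimes> K_0, so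
  it is supported on the empty set.\<close>

fun chase :: "(nat \<Rightarrow> ('v, 'k) mpoly) \<Rightarrow> nat \<Rightarrow> nat \<Rightarrow> 'v set \<Rightarrow> ('v, 'k) mpoly" where
  "chase u 0 b S = (if S = {} then u b else 0)"
| "chase u (Suc n) a S = khomotopy (\<lambda>S. \<Sum>b<r (c - n). D (c - n) a b * chase u n b S) S"

definition chase_down :: "(nat \<Rightarrow> ('v, 'k) mpoly) \<Rightarrow> nat \<Rightarrow> nat \<Rightarrow> 'v set \<Rightarrow> ('v, 'k) mpoly" where
  "chase_down u i = chase u (c - i)"

lemma chase_down_step:
  assumes "i < c"
  shows "chase_down u i a =
    khomotopy (\<lambda>S. \<Sum>b<r (Suc i). D (Suc i) a b * chase_down u (Suc i) b S)"
proof -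
  have "c - i = Suc (c - Suc i)" "c - (c - Suc i) = Suc i" using assms by auto
  then show ?thesis by (intro ext) (simp add: chase_down_def)
qed

text \<open>At each stage the differential of the previous element must be a Koszul boundary. It is
  a Koszul cycle because consecutive differentials compose to 0, and its coefficient at the empty
  set lies in \<mm> by minimality of the resolution.\<close>

lemma zigzag_chase_down: "zigzag u (chase_down u)"
proof -
  have "\<forall>a<r i. \<forall>S. kdiff (chase_down u i a) S = (\<Sum>b<r (Suc i). D (Suc i) a b * chase_down u (Suc i) b S)"
    if "i < c" for i
    using that
  proof (induction "c - Suc i" arbitrary: i)
    case 0
    then have c: "Suc i = c" by simp
    show ?case
      unfolding chase_down_step[OF 0(2)]
    proof (intro allI impI koszul_exact)
      fix a S assume "a < r i"
      \<comment> \<open>The boundary only reads values at sets \<open>insert x S\<close>, which are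
        never empty, whereas the starting element is supported on the empty set.\<close>
      show "kdiff (\<lambda>S. \<Sum>b<r (Suc i). D (Suc i) a b * chase_down u (Suc i) b S) S = 0"
        by (simp add: kdiff_sum kdiff_def chase_down_def c)
      show "(\<Sum>b<r (Suc i). D (Suc i) a b * chase_down u (Suc i) b {}) \<in> irrelevant_ideal"
        using \<open>a < r i\<close> 0(2)
        by (auto intro!: ideal.subspace_sum[OF is_ideal_irrelevant]
            is_ideal_mult_right[OF is_ideal_irrelevant] irr)
    qed
  next
    case (Suc n)
    then have i: "Suc i < c" by simp
    have n: "n = c - Suc (Suc i)" using Suc(2) by simp
    show ?case
      unfolding chase_down_step[OF Suc(3)]
    proof (intro allI impI koszul_exact)
      fix a S assume a: "a < r i"
      have "kdiff (\<lambda>S. \<Sum>b<r (Suc i). D (Suc i) a b * chase_down u (Suc i) b S) S =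
          (\<Sum>b<r (Suc i). D (Suc i) a b * kdiff (chase_down u (Suc i) b) S)"
        by (rule kdiff_sum)
      also have "\<dots> = (\<Sum>b<r (Suc i). D (Suc i) a b * (\<Sum>l<r (Suc (Suc i)).
          D (Suc (Suc i)) b l * chase_down u (Suc (Suc i)) l S))"
        using Suc(1)[OF n i] by simp
      also have "\<dots> = (\<Sum>l<r (Suc (Suc i)). (\<Sum>b<r (Suc i). D (Suc i) a b * D (Suc (Suc i)) b l) *
          chase_down u (Suc (Suc i)) l S)"
        by (simp add: sum_distrib_left sum_distrib_right mult.assoc
            sum.swap[of _ "{..<r (Suc i)}" "{..<r (Suc (Suc i))}"])
      also have "\<dots> = 0" using composition_0[OF i a] by simp
      finally show "kdiff (\<lambda>S. \<Sum>b<r (Suc i). D (Suc i) a b * chase_down u (Suc i) b S) S = 0" .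
      show "(\<Sum>b<r (Suc i). D (Suc i) a b * chase_down u (Suc i) b {}) \<in> irrelevant_ideal"
        using a Suc(3)
        by (auto intro!: ideal.subspace_sum[OF is_ideal_irrelevant]
            is_ideal_mult_right[OF is_ideal_irrelevant] irr)
    qed
  qed
  then show ?thesis by (simp add: zigzag_def) (simp add: chase_down_def)
qed

lemma hom_of_degree_chase_down:
  assumes u: "\<And>b. b < r c \<Longrightarrow> hom_of_degree (t - e c b) (u b)" and "i \<le> c" "a < r i"
  shows "hom_of_degree (t - e i a - int (card S)) (chase_down u i a S)"
  using assms(2,3)
proof (induction "c - i" arbitrary: i a S)
  case 0
  then have "i = c" by simp
  then show ?case using u 0 by (simp add: chase_down_def)
next
  case (Suc n)
  then have i: "i < c" by simp
  show ?case
    unfolding chase_down_step[OF i]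
  proof (intro hom_of_degree_khomotopy hom_of_degree_sum)
    fix b S assume "b \<in> {..<r (Suc i)}"
    then have b: "b < r (Suc i)" by simp
    have "hom_of_degree (t - e (Suc i) b - int (card S)) (chase_down u (Suc i) b S)"
      using Suc(2) i b by (intro Suc(1)) auto
    from hom_of_degree_mult[OF hom[OF i Suc(4) b] this]
    show "hom_of_degree (t - e i a - int (card S)) (D (Suc i) a b * chase_down u (Suc i) b S)"
      by (simp add: algebra_simps)
  qed
qed

text \<open>Zigzags are closed under linear combinations, so independence can be tested on
  combinations without knowing that the chase itself is linear.\<close>

lemma zigzag_sum:
  assumes "\<And>j. j \<in> J \<Longrightarrow> zigzag (u j) (W j)"
  shows "zigzag (\<lambda>b. \<Sum>j\<in>J. f j * u j b) (\<lambda>i b S. \<Sum>j\<in>J. f j * W j i b S)"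
proof -
  have "kdiff (\<lambda>S. \<Sum>j\<in>J. f j * W j i a S) S =
      (\<Sum>b<r (Suc i). D (Suc i) a b * (\<Sum>j\<in>J. f j * W j (Suc i) b S))" if "i < c" "a < r i" for i a S
  proof -
    have "kdiff (\<lambda>S. \<Sum>j\<in>J. f j * W j i a S) S = (\<Sum>j\<in>J. f j * kdiff (W j i a) S)"
      by (rule kdiff_sum)
    also have "\<dots> = (\<Sum>j\<in>J. f j * (\<Sum>b<r (Suc i). D (Suc i) a b * W j (Suc i) b S))"
      using assms that by (simp add: zigzag_def)
    also have "\<dots> = (\<Sum>b<r (Suc i). D (Suc i) a b * (\<Sum>j\<in>J. f j * W j (Suc i) b S))"
      by (simp add: sum_distrib_left mult.left_commute sum.swap[of _ J "{..<r (Suc i)}"])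
    finally show ?thesis .
  qed
  then show ?thesis using assms by (simp add: zigzag_def)
qed

text \<open>The boundary at the complement of \<open>x\<close> has the single term \<plusminus>x
  times the top coefficient, and the zigzag condition places this boundary in the image of F_1,
  which is \<open>I\<close>. The sign is removed by multiplying with it once more.\<close>

lemma zigzag_socle:
  assumes W: "zigzag u W" and c: "0 < c"
  shows "var x * W 0 0 UNIV \<in> I"
proof -
  have "kdiff (W 0 0) (UNIV - {x}) = const (ksign x (UNIV - {x})) * (var x * W 0 0 UNIV)"
  proof -
    have "- (UNIV - {x}) = {x}" "insert x (UNIV - {x}) = UNIV" by auto
    then show ?thesis by (simp only: kdiff_def) simp
  qed
  moreover have "kdiff (W 0 0) (UNIV - {x}) \<in> I"
    using W c r_0 mem_iff[of "kdiff (W 0 0) (UNIV - {x})"]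
    by (auto simp: zigzag_def)
  ultimately have "const (ksign x (UNIV - {x})) * (const (ksign x (UNIV - {x})) * (var x * W 0 0 UNIV)) \<in> I"
    by (simp add: is_ideal_mult_left[OF is_ideal])
  moreover have "const (ksign x (UNIV - {x})) * const (ksign x (UNIV - {x})) = (1 :: ('v, 'k) mpoly)"
  proof -
    have "ksign x (UNIV - {x}) * ksign x (UNIV - {x}) = (1 :: 'k)"
      by (simp add: ksign_def flip: power_mult_distrib)
    then show ?thesis by (simp flip: const_mult)
  qed
  ultimately show ?thesis by (simp only: mult.assoc[symmetric] mult_1_left)
qed

text \<open>The chase is run backwards. At stage i, W_i equals a Koszul boundary of some V plus the
  image under the differential of some V'. As the Koszul differential squares to 0, W_{i+1} minus
  the boundary of V' is a cycle of the resolution, hence a boundary, and V' takes the place of V. At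
  stage c injectivity makes W_c the Koszul boundary of V', and boundaries have coefficients in
  \<mm>.\<close>

lemma zigzag_injective:
  assumes W: "zigzag u W" and c: "c = CARD('v)" and I: "W 0 0 UNIV \<in> I" and b: "b < r c"
  shows "u b \<in> irrelevant_ideal"
proof -
  have c0: "0 < c" by (simp add: c)
  have defect: "(\<Sum>b<r (Suc i). D (Suc i) a b * (W (Suc i) b S - kdiff (V' b) S)) = 0"
    if V: "\<forall>a<r i. \<forall>S. card S = c - i \<longrightarrow>
        W i a S - kdiff (V a) S = (\<Sum>b<r (Suc i). D (Suc i) a b * V' b S)"
      and i: "i < c" and a: "a < r i" and S: "card S = c - Suc i" for i a V V' S
  proof -
    have "(\<Sum>b<r (Suc i). D (Suc i) a b * (W (Suc i) b S - kdiff (V' b) S)) =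
        kdiff (W i a) S - kdiff (\<lambda>S. \<Sum>b<r (Suc i). D (Suc i) a b * V' b S) S"
      using W i a by (simp add: zigzag_def kdiff_sum right_diff_distrib sum_subtractf)
    also have "kdiff (\<lambda>S. \<Sum>b<r (Suc i). D (Suc i) a b * V' b S) S = kdiff (\<lambda>S. W i a S - kdiff (V a) S) S"
      using V a S i by (intro kdiff_cong) auto
    also have "\<dots> = kdiff (W i a) S - kdiff (kdiff (V a)) S" by (rule kdiff_diff)
    finally show ?thesis by (simp add: kdiff_kdiff)
  qed
  have "\<exists>V V'. \<forall>a<r i. \<forall>S. card S = c - i \<longrightarrow>
      W i a S - kdiff (V a) S = (\<Sum>b<r (Suc i). D (Suc i) a b * V' b S)" if "i < c" for i
    using that
  proof (induction i)
    case 0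
    obtain v where v: "W 0 0 UNIV = (\<Sum>b<r 1. D 1 0 b * v b)" using I unfolding mem_iff by blast
    have "S = UNIV" if "card S = c" for S :: "'v set" using that c by (simp add: card_eq_UNIV_imp_eq_UNIV)
    then show ?case using v r_0
      by (intro exI[of _ "\<lambda>_ _. 0"] exI[of _ "\<lambda>b S. v b"]) (auto simp: kdiff_def)
  next
    case (Suc i)
    then obtain V V' where V: "\<forall>a<r i. \<forall>S. card S = c - i \<longrightarrow>
      W i a S - kdiff (V a) S = (\<Sum>b<r (Suc i). D (Suc i) a b * V' b S)" by auto
    have "\<exists>w. card S = c - Suc i \<longrightarrow> (\<forall>b<r (Suc i). W (Suc i) b S - kdiff (V' b) S =
        (\<Sum>l<r (Suc (Suc i)). D (Suc (Suc i)) b l * w l))" for S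
    proof (cases "card S = c - Suc i")
      case S: True
      have "\<forall>a<r i. (\<Sum>b<r (Suc i). D (Suc i) a b * (W (Suc i) b S - kdiff (V' b) S)) = 0"
        using defect[OF V _ _ S] Suc.prems by simp
      then obtain w where "\<forall>b<r (Suc i). W (Suc i) b S - kdiff (V' b) S =
        (\<Sum>l<r (Suc (Suc i)). D (Suc (Suc i)) b l * w l)"
        unfolding exact[OF Suc.prems] by (rule exE)
      then show ?thesis by (intro exI[of _ w] impI)
    qed simp
    then have "\<forall>S. \<exists>w. card S = c - Suc i \<longrightarrow> (\<forall>b<r (Suc i). W (Suc i) b S - kdiff (V' b) S =
        (\<Sum>l<r (Suc (Suc i)). D (Suc (Suc i)) b l * w l))" by (rule allI)
    then obtain w where "\<forall>S. card S = c - Suc i \<longrightarrow> (\<forall>b<r (Suc i). W (Suc i) b S - kdiff (V' b) S =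
        (\<Sum>l<r (Suc (Suc i)). D (Suc (Suc i)) b l * w S l))" by (rule choice[THEN exE])
    then show ?case by (intro exI[of _ V'] exI[of _ "\<lambda>l S. w S l"] allI impI) simp
  qed
  from this[of "c - 1"] c0 obtain V V' where V: "\<forall>a<r (c - 1). \<forall>S. card S = c - (c - 1) \<longrightarrow>
      W (c - 1) a S - kdiff (V a) S = (\<Sum>b<r (Suc (c - 1)). D (Suc (c - 1)) a b * V' b S)"
    by auto
  have Sc: "Suc (c - 1) = c" using c0 by simp
  have "W (Suc (c - 1)) b {} - kdiff (V' b) {} = 0"
    by (rule inj[where i = "c - 1" and v = "\<lambda>b. W (Suc (c - 1)) b {} - kdiff (V' b) {}", OF Sc])
      (use defect[OF V, of _ "{}"] Sc b in auto)
  then have "W c b {} = kdiff (V' b) {}" unfolding Sc by simp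
  then show ?thesis
    using W b kdiff_irrelevant[of "V' b" "{}"] by (simp add: zigzag_def)
qed

text \<open>The zigzags starting at the basis vectors of F_c. The shift by \<open>c\<close> is the
  degree of the top Koszul generator. Independence modulo \<open>I\<close> over k is asserted, not
  that the \<open>p j\<close> span the socle.\<close>

theorem socle_basis:
  assumes c: "c = CARD('v)"
  obtains p where "\<And>j. j < r c \<Longrightarrow> hom_of_degree (e c j - int c) (p j)"
    "\<And>j x. j < r c \<Longrightarrow> var x * p j \<in> I"
    "\<And>l j. (\<Sum>j<r c. const (l j) * p j) \<in> I \<Longrightarrow> j < r c \<Longrightarrow> l j = 0"
proof
  define u where "u j = (\<lambda>b::nat. if b = j then 1 else 0 :: ('v, 'k) mpoly)" for j
  define p where "p j = chase_down (u j) 0 0 UNIV" for j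
  fix j assume j: "j < r c"
  have "hom_of_degree (e c j - e 0 0 - int (card (UNIV :: 'v set))) (p j)"
    unfolding p_def using r_0
    by (intro hom_of_degree_chase_down) (auto simp: u_def hom_of_degree_1)
  then show "hom_of_degree (e c j - int c) (p j)" by (simp add: e_0 c)
  show "var x * p j \<in> I" for x
    unfolding p_def by (rule zigzag_socle[OF zigzag_chase_down]) (simp add: c)
  fix l assume "(\<Sum>j<r c. const (l j) * p j) \<in> I"
  then have "(\<Sum>j'<r c. const (l j') * u j' j) \<in> irrelevant_ideal"
    using zigzag_injective[OF zigzag_sum[OF zigzag_chase_down] c _ j, where J2 = "{..<r c}" and f2 = "\<lambda>j. const (l j)" and u2 = u]
    by (simp add: p_def)
  moreover have "(\<Sum>j'<r c. const (l j') * u j' j) = const (l j)"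
    using j by (simp add: u_def if_distrib[of "\<lambda>a. _ * a"] cong: if_cong)
  ultimately show "l j = 0" by (simp add: irrelevant_ideal_iff)
qed

end

section \<open>Coordinates of a minimal resolution given by matrices\<close>

lemma graded_hom_entry:
  assumes "graded_hom F G A" "i < rank G" "j < rank F"
  shows "hom_of_degree (degs F ! j - degs G ! i) (A $$ (i, j))"
proof -
  have A: "A \<in> carrier_mat (rank G) (rank F)" using assms(1) by (simp add: graded_hom_def)
  have "unit_vec (rank F) j \<in> hcomp F (degs F ! j)"
    using assms(3) by (auto simp: hcomp_def unit_vec_def hom_of_degree_1)
  then have "A *\<^sub>v unit_vec (rank F) j \<in> hcomp G (degs F ! j)"
    using assms(1) by (auto simp: graded_hom_def)
  moreover have "(A *\<^sub>v unit_vec (rank F) j) $ i = A $$ (i, j)"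
    using A assms(2,3) by simp
  ultimately show ?thesis using assms(2) by (auto simp: hcomp_def)
qed

lemma mult_mat_vec_index_sum:
  "A \<in> carrier_mat n m \<Longrightarrow> v \<in> carrier_vec m \<Longrightarrow> i < n \<Longrightarrow> (A *\<^sub>v v) $ i = (\<Sum>j<m. A $$ (i, j) * v $ j)"
  by (auto simp: scalar_prod_def atLeast0LessThan)

text \<open>Vectors are replaced by functions on the naturals whose values beyond the rank are never
  read, so that later arguments need no carrier conditions.\<close>

lemma minimal_resolution_coordinates:
  assumes res: "minimal_resolution c I F \<delta>" and c: "0 < c"
  shows "resolution c I (\<lambda>i. rank (F i)) (\<lambda>i b. degs (F i) ! b) (\<lambda>i a b. \<delta> i $$ (a, b))"
proof
  let ?r = "\<lambda>i. rank (F i)"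
  have F0: "F 0 = Free [0]" using res by (simp add: minimal_resolution_def)
  then show "?r 0 = 1" "degs (F 0) ! 0 = 0" by (simp_all add: rank_def)
  have graded: "\<forall>i\<in>{1..c}. graded_hom (F i) (F (i - 1)) (\<delta> i)"
    and exact: "\<forall>i\<in>{1..<c}. (\<lambda>v. \<delta> (i + 1) *\<^sub>v v) ` carrier_vec (?r (i + 1)) = mat_kernel (\<delta> i)"
    and minimal: "\<forall>i\<in>{1..c}. elements_mat (\<delta> i) \<subseteq> irrelevant_ideal"
    using res by (simp_all add: minimal_resolution_def)
  have gh: "graded_hom (F (Suc i)) (F i) (\<delta> (Suc i))" if "i < c" for i
    using bspec[OF graded, of "Suc i"] that by simp
  then have carrier: "\<delta> (Suc i) \<in> carrier_mat (?r i) (?r (Suc i))" if "i < c" for i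
    using that by (simp add: graded_hom_def)
  show "hom_of_degree (degs (F (Suc i)) ! b - degs (F i) ! a) (\<delta> (Suc i) $$ (a, b))"
    if "i < c" "a < ?r i" "b < ?r (Suc i)" for i a b
    using graded_hom_entry[OF gh] that by blast
  show "\<delta> (Suc i) $$ (a, b) \<in> irrelevant_ideal" if "i < c" "a < ?r i" "b < ?r (Suc i)" for i a b
  proof -
    have "elements_mat (\<delta> (Suc i)) \<subseteq> irrelevant_ideal"
      using bspec[OF minimal, of "Suc i"] that(1) by simp
    then show ?thesis using carrier[OF that(1)] that(2,3) by (auto intro: elements_matI)
  qed
  have ker: "w \<in> mat_kernel (\<delta> (Suc i)) \<longleftrightarrow> w \<in> carrier_vec (?r (Suc i)) \<and>
      (\<forall>a<?r i. (\<Sum>b<?r (Suc i). \<delta> (Suc i) $$ (a, b) * w $ b) = 0)" if "i < c" for i w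
    using carrier[OF that] mult_mat_vec_index_sum[OF carrier[OF that], of w]
    unfolding mat_kernel[OF carrier[OF that]] by (auto simp: vec_eq_iff)
  show "p \<in> I \<longleftrightarrow> (\<exists>v. p = (\<Sum>b<?r 1. \<delta> 1 $$ (0, b) * v b))" for p
  proof -
    have im: "(\<lambda>v. \<delta> 1 *\<^sub>v v) ` carrier_vec (?r 1) = {w \<in> carrier_vec 1. w $ 0 \<in> I}"
      using res by (simp add: minimal_resolution_def)
    have c1: "\<delta> 1 \<in> carrier_mat 1 (?r 1)" using carrier[OF c] F0 by (simp add: rank_def)
    have z: "0 < (1 :: nat)" by simp
    show ?thesis
    proof
      assume "p \<in> I"
      then have "vec 1 (\<lambda>_. p) \<in> (\<lambda>v. \<delta> 1 *\<^sub>v v) ` carrier_vec (?r 1)" unfolding im by simp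
      then obtain v where v: "v \<in> carrier_vec (?r 1)" "vec 1 (\<lambda>_. p) = \<delta> 1 *\<^sub>v v" by blast
      have "p = vec 1 (\<lambda>_. p) $ 0" by simp
      also have "\<dots> = (\<Sum>b<?r 1. \<delta> 1 $$ (0, b) * v $ b)"
        unfolding v(2) by (rule mult_mat_vec_index_sum[OF c1 v(1) z])
      finally show "\<exists>v. p = (\<Sum>b<?r 1. \<delta> 1 $$ (0, b) * v b)"
        by (intro exI[of _ "\<lambda>b. v $ b"])
    next
      assume "\<exists>v. p = (\<Sum>b<?r 1. \<delta> 1 $$ (0, b) * v b)"
      then obtain v where v: "p = (\<Sum>b<?r 1. \<delta> 1 $$ (0, b) * v b)" by (rule exE)
      have "\<delta> 1 *\<^sub>v vec (?r 1) v \<in> {w \<in> carrier_vec 1. w $ 0 \<in> I}"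
        unfolding im[symmetric] by (intro imageI vec_carrier)
      then have "(\<delta> 1 *\<^sub>v vec (?r 1) v) $ 0 \<in> I" unfolding mem_Collect_eq by (rule conjunct2)
      moreover have "(\<delta> 1 *\<^sub>v vec (?r 1) v) $ 0 = p"
        unfolding mult_mat_vec_index_sum[OF c1 vec_carrier z] v by (intro sum.cong) simp_all
      ultimately show "p \<in> I" by (simp only:)
    qed
  qed
  show "(\<forall>a<?r i. (\<Sum>b<?r (Suc i). \<delta> (Suc i) $$ (a, b) * v b) = 0) \<longleftrightarrow>
      (\<exists>w. \<forall>b<?r (Suc i). v b = (\<Sum>l<?r (Suc (Suc i)). \<delta> (Suc (Suc i)) $$ (b, l) * w l))"
    if i: "Suc i < c" for i v
  proof -
    have im: "(\<lambda>v. \<delta> (Suc (Suc i)) *\<^sub>v v) ` carrier_vec (?r (Suc (Suc i))) = mat_kernel (\<delta> (Suc i))"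
      using bspec[OF exact, of "Suc i"] i by simp
    have c2: "\<delta> (Suc (Suc i)) \<in> carrier_mat (?r (Suc i)) (?r (Suc (Suc i)))" using carrier[OF i] .
    let ?v = "vec (?r (Suc i)) v"
    have "(\<forall>a<?r i. (\<Sum>b<?r (Suc i). \<delta> (Suc i) $$ (a, b) * v b) = 0) \<longleftrightarrow> ?v \<in> mat_kernel (\<delta> (Suc i))"
      using ker[of i ?v] i by simp
    also have "\<dots> \<longleftrightarrow> (\<exists>w. \<forall>b<?r (Suc i). v b = (\<Sum>l<?r (Suc (Suc i)). \<delta> (Suc (Suc i)) $$ (b, l) * w l))"
      unfolding im[symmetric]
    proof
      assume "?v \<in> (\<lambda>v. \<delta> (Suc (Suc i)) *\<^sub>v v) ` carrier_vec (?r (Suc (Suc i)))"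
      then obtain w where w: "w \<in> carrier_vec (?r (Suc (Suc i)))" "?v = \<delta> (Suc (Suc i)) *\<^sub>v w"
        by (elim imageE)
      have "v b = (\<Sum>l<?r (Suc (Suc i)). \<delta> (Suc (Suc i)) $$ (b, l) * w $ l)" if "b < ?r (Suc i)" for b
        using mult_mat_vec_index_sum[OF c2 w(1) that] w(2) that by (metis index_vec)
      then show "\<exists>w. \<forall>b<?r (Suc i). v b = (\<Sum>l<?r (Suc (Suc i)). \<delta> (Suc (Suc i)) $$ (b, l) * w l)"
        by (intro exI[of _ "\<lambda>l. w $ l"] allI impI)
    next
      assume "\<exists>w. \<forall>b<?r (Suc i). v b = (\<Sum>l<?r (Suc (Suc i)). \<delta> (Suc (Suc i)) $$ (b, l) * w l)"
      then obtain w where w: "\<forall>b<?r (Suc i). v b = (\<Sum>l<?r (Suc (Suc i)). \<delta> (Suc (Suc i)) $$ (b, l) * w l)"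
        by (rule exE)
      have "?v = \<delta> (Suc (Suc i)) *\<^sub>v vec (?r (Suc (Suc i))) w"
      proof (rule eq_vecI)
        show "dim_vec ?v = dim_vec (\<delta> (Suc (Suc i)) *\<^sub>v vec (?r (Suc (Suc i))) w)" using c2 by simp
        fix b assume "b < dim_vec (\<delta> (Suc (Suc i)) *\<^sub>v vec (?r (Suc (Suc i))) w)"
        then have b: "b < ?r (Suc i)" using c2 by simp
        show "?v $ b = (\<delta> (Suc (Suc i)) *\<^sub>v vec (?r (Suc (Suc i))) w) $ b"
          using mult_mat_vec_index_sum[OF c2 vec_carrier b, of w] w b by simp
      qed
      then show "?v \<in> (\<lambda>v. \<delta> (Suc (Suc i)) *\<^sub>v v) ` carrier_vec (?r (Suc (Suc i)))"
        by (rule image_eqI[OF _ vec_carrier])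
    qed
    finally show ?thesis .
  qed
  show "v b = 0"
    if i: "Suc i = c" and v: "\<forall>a<?r i. (\<Sum>b<?r (Suc i). \<delta> (Suc i) $$ (a, b) * v b) = 0"
      and b: "b < ?r (Suc i)" for i v b
  proof -
    have "vec (?r (Suc i)) v \<in> mat_kernel (\<delta> (Suc i))" using ker[of i "vec (?r (Suc i)) v"] i v by simp
    then have "vec (?r (Suc i)) v = 0\<^sub>v (?r (Suc i))" using res i by (simp add: minimal_resolution_def)
    then show ?thesis using b by (metis index_vec index_zero_vec(1))
  qed
qed

section \<open>Gorenstein duality\<close>

lemma hom_of_degree_neg: "hom_of_degree d p \<Longrightarrow> d < 0 \<Longrightarrow> p = 0"
  using keys_eq_empty[of p] by (fastforce simp: hom_of_degree_def)

text \<open>The chain consists of the ideals I + R_{\<ge>i}, described through components. Once it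
  is constant, a form of degree i lies in \<open>J i\<close> = \<open>J (Suc i)\<close>, which says
  that it lies in \<open>I\<close>.\<close>

lemma artinian_high_degree:
  assumes hI: "homogeneous_ideal I" and art: "artinian_quotient I"
  obtains N where "\<And>t p. int N \<le> t \<Longrightarrow> hom_of_degree t p \<Longrightarrow> p \<in> I"
proof -
  note I = homogeneous_ideal_is_ideal[OF hI]
  define J where "J i = {p. \<forall>t<int i. hcomponent t p \<in> I}" for i
  have "is_ideal (J i)" for i
  proof (rule ideal.subspaceI)
    show "0 \<in> J i" by (simp add: J_def ideal.subspace_0[OF I])
    show "x + y \<in> J i" if "x \<in> J i" "y \<in> J i" for x y
      using that by (simp add: J_def hcomponent_add ideal.subspace_add[OF I])
    show "q * x \<in> J i" if x: "x \<in> J i" for q x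
    proof -
      let ?S = "(\<lambda>m. int (mdeg m)) ` Poly_Mapping.keys q"
      have "hcomponent t (q * x) \<in> I" if t: "t < int i" for t
      proof -
        have "q * x = (\<Sum>s\<in>?S. hcomponent s q * x)"
          by (subst (1) sum_hcomponent[of q]) (rule sum_distrib_right)
        then have "hcomponent t (q * x) = (\<Sum>s\<in>?S. hcomponent s q * hcomponent (t - s) x)"
          by (simp add: hcomponent_sum hcomponent_mult_hom[OF hom_of_degree_hcomponent])
        moreover have "hcomponent s q * hcomponent (t - s) x \<in> I" if "s \<in> ?S" for s
          using that x t by (intro is_ideal_mult_left[OF I]) (auto simp: J_def)
        ultimately show ?thesis by (simp add: ideal.subspace_sum[OF I])
      qed
      then show ?thesis by (simp add: J_def)
    qed
  qed
  moreover have "I \<subseteq> J i" for i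
    using homogeneous_ideal_hcomponent[OF hI] by (auto simp: J_def)
  moreover have "decseq J" by (force simp: decseq_def J_def)
  ultimately obtain N where N: "\<forall>i\<ge>N. J i = J N"
    using art unfolding artinian_quotient_def by blast
  have "p \<in> I" if t: "int N \<le> t" and p: "hom_of_degree t p" for t p
  proof -
    define i where "i = nat t"
    have i: "t = int i" "N \<le> i" using t by (auto simp: i_def)
    have "p \<in> J i" using ideal.subspace_0[OF I] by (auto simp: J_def hcomponent_hom[OF p] i(1))
    also have "J i = J (Suc i)" using N i(2) by (metis le_SucI)
    finally have "hcomponent t p \<in> I" by (simp add: J_def i(1))
    then show ?thesis by (simp add: hcomponent_hom[OF p])
  qed
  then show ?thesis by (rule that)
qed

text \<open>Here \<sigma> is the socle degree and \<open>s\<close> a homogeneous socle generator.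
  The condition \<open>extend\<close> is nondegeneracy of the multiplication pairing with values in
  degree \<sigma> of R/I.\<close>

locale gorenstein_socle =
  fixes I :: "('v::finite, 'k::field) mpoly set" and \<sigma> :: int and s :: "('v, 'k) mpoly"
  assumes hideal: "homogeneous_ideal I"
    and s_hom: "hom_of_degree \<sigma> s" and s_notin: "s \<notin> I"
    and socle: "(\<And>x. var x * t \<in> I) \<Longrightarrow> \<exists>a. t - const a * s \<in> I"
    and extend: "hom_of_degree d p \<Longrightarrow> p \<notin> I \<Longrightarrow> \<exists>q. hom_of_degree (\<sigma> - d) q \<and> q * p \<notin> I"

text \<open>The given socle generator need not be homogeneous, but a component of it outside
  \<open>I\<close> is again in the socle and spans it. For \<open>extend\<close>, a form outside
  \<open>I\<close> is multiplied by variables as long as it stays outside; this ends below degree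
  \<open>N\<close>, in the socle, and comparing components shows that the final degree is
  \<sigma>.\<close>

lemma gorenstein_ideal_socle:
  assumes "gorenstein_ideal I"
  obtains \<sigma> s where "gorenstein_socle I \<sigma> s"
proof -
  have hI: "homogeneous_ideal I" and art: "artinian_quotient I"
    using assms by (auto simp: gorenstein_ideal_def)
  note I = homogeneous_ideal_is_ideal[OF hI]
  from assms obtain s0 where s0: "s0 \<in> colon I irrelevant_ideal" "s0 \<notin> I"
    "\<And>t. t \<in> colon I irrelevant_ideal \<Longrightarrow> \<exists>a. t - const a * s0 \<in> I"
    unfolding gorenstein_ideal_def by blast
  obtain \<sigma> where \<sigma>: "hcomponent \<sigma> s0 \<notin> I"
    using homogeneous_ideal_memI[OF I, of s0] s0(2) by blast
  define s where "s = hcomponent \<sigma> s0"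
  have s_hom: "hom_of_degree \<sigma> s" by (simp add: s_def hom_of_degree_hcomponent)
  have s_notin: "s \<notin> I" using \<sigma> by (simp add: s_def)
  have "var x * s \<in> I" for x
  proof -
    have "hcomponent (\<sigma> + 1) (var x * s0) \<in> I"
      using s0(1) by (intro homogeneous_ideal_hcomponent[OF hI]) (simp add: colon_irrelevant_iff[OF I])
    then show ?thesis by (simp add: hcomponent_mult_hom[OF hom_of_degree_var] s_def)
  qed
  then obtain b where b: "s - const b * s0 \<in> I"
    using s0(3)[of s] by (auto simp: colon_irrelevant_iff[OF I])
  have b0: "b \<noteq> 0" using b s_notin by auto
  have socle: "\<exists>a. t - const a * s \<in> I" if t: "\<And>x. var x * t \<in> I" for t
  proof -
    obtain a where a: "t - const a * s0 \<in> I"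
      using s0(3)[of t] t by (auto simp: colon_irrelevant_iff[OF I])
    \<comment> \<open>From t \<equiv> a s0 and s \<equiv> b s0 modulo \<open>I\<close> follows t
      \<equiv> (a/b) s.\<close>
    have "(t - const a * s0) - const (a / b) * (s - const b * s0) \<in> I"
      by (rule ideal.subspace_diff[OF I a ideal.subspace_scale[OF I b]])
    also have "(t - const a * s0) - const (a / b) * (s - const b * s0) =
        t - const (a / b) * s + (const (a / b) * const b - const a) * s0"
      by (simp add: right_diff_distrib left_diff_distrib mult.assoc)
    also have "const (a / b) * const b = const a" using b0 by (simp flip: const_mult)
    finally show ?thesis by auto
  qed
  obtain N where N: "\<And>t p. int N \<le> t \<Longrightarrow> hom_of_degree t p \<Longrightarrow> p \<in> I"
    using artinian_high_degree[OF hI art] by blast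
  have extend: "\<exists>q. hom_of_degree (\<sigma> - d) q \<and> q * p \<notin> I" if "hom_of_degree d p" "p \<notin> I" for d p
    using that
  proof (induction "nat (int N - d)" arbitrary: d p rule: less_induct)
    case less
    have d: "d < int N" using N[of d p] less.prems by force
    show ?case
    proof (cases "\<forall>x. var x * p \<in> I")
      case True
      then obtain a where a: "p - const a * s \<in> I" using socle by blast
      have "d = \<sigma>"
      proof (rule ccontr)
        assume ne: "d \<noteq> \<sigma>"
        have "hcomponent d (p - const a * s) \<in> I" by (rule homogeneous_ideal_hcomponent[OF hI a])
        moreover have "hcomponent d (p - const a * s) = hcomponent d p - const a * hcomponent d s"
          by (rule poly_mapping_eqI) (simp add: lookup_hcomponent lookup_minus)
        ultimately show False
          using ne less.prems by (simp add: hcomponent_hom[OF s_hom] hcomponent_hom[OF less.prems(1)])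
      qed
      then show ?thesis using less.prems by (intro exI[of _ 1]) (simp add: hom_of_degree_1)
    next
      case False
      then obtain x where x: "var x * p \<notin> I" by blast
      have h: "hom_of_degree (d + 1) (var x * p)"
        using hom_of_degree_mult[OF hom_of_degree_var less.prems(1)] by (simp add: add.commute)
      have "nat (int N - (d + 1)) < nat (int N - d)" using d by simp
      from less.hyps[OF this h x] obtain q where
        q: "hom_of_degree (\<sigma> - (d + 1)) q" "q * (var x * p) \<notin> I" by blast
      have "hom_of_degree (\<sigma> - d) (q * var x)"
        using hom_of_degree_mult[OF q(1) hom_of_degree_var] by simp
      then show ?thesis using q(2) by (intro exI[of _ "q * var x"]) (simp add: mult.assoc)
    qed
  qed
  show ?thesis
    by (rule that, unfold_locales) (use hI s_hom s_notin socle extend in blast)+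
qed

lemma vector_space_pair_mpoly:
  "vector_space_pair (\<lambda>a p. const a * p :: ('v::finite, 'k::field) mpoly) ((*) :: 'k \<Rightarrow> 'k \<Rightarrow> 'k)"
proof unfold_locales
  fix a b :: 'k and x y :: "('v, 'k) mpoly"
  show "const a * (x + y) = const a * x + const a * y" by (rule distrib_left)
  show "const (a + b) * x = const a * x + const b * x" by (simp only: const_add distrib_right)
  show "const a * (const b * x) = const (a * b) * x" by (simp only: const_mult mult.assoc)
  show "const 1 * x = x" by simp
next
  fix a b x y :: 'k
  show "a * (x + y) = a * x + a * y" by (rule distrib_left)
  show "(a + b) * x = a * x + b * x" by (rule distrib_right)
  show "a * (b * x) = (a * b) * x" by (rule mult.assoc[symmetric])
  show "1 * x = x" by (rule mult_1_left)
qed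

text \<open>The conditions on \<open>W\<close> make it a k-subspace, scalars acting through
  \<open>const\<close>. Adjoining \<open>x\<close> to a basis of \<open>W\<close> keeps it
  independent, so the values of a functional can be prescribed there.\<close>

lemma separating_functional:
  fixes W :: "('v::finite, 'k::field) mpoly set"
  assumes W: "0 \<in> W" "\<And>x y. x \<in> W \<Longrightarrow> y \<in> W \<Longrightarrow> x + y \<in> W" "\<And>a x. x \<in> W \<Longrightarrow> const a * x \<in> W"
    and x: "x \<notin> W"
  obtains L :: "('v, 'k) mpoly \<Rightarrow> 'k"
  where "\<And>y z. L (y + z) = L y + L z" "\<And>a y. L (const a * y) = a * L y"
    "L x = 1" "\<And>w. w \<in> W \<Longrightarrow> L w = 0"
proof -
  interpret V: vector_space_pair "\<lambda>a p. const a * p :: ('v, 'k) mpoly" "(*) :: 'k \<Rightarrow> 'k \<Rightarrow> 'k"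
    by (rule vector_space_pair_mpoly)
  have sub: "V.vs1.subspace W" using W by (intro V.vs1.subspaceI)
  obtain B where B: "B \<subseteq> W" "V.vs1.independent B" "W \<subseteq> V.vs1.span B"
    by (rule V.vs1.maximal_independent_subset)
  have "V.vs1.span B \<subseteq> W" by (rule V.vs1.span_minimal[OF B(1) sub])
  then have xB: "x \<notin> V.vs1.span B" using x by blast
  then have "V.vs1.independent (insert x B)"
    using B(2) by (rule V.vs1.independent_insertI)
  then obtain L where L: "Vector_Spaces.linear (\<lambda>a p. const a * p) (*) L"
    "\<forall>y\<in>insert x B. L y = (if y = x then 1 else 0 :: 'k)"
    using V.linear_independent_extend[of "insert x B" "\<lambda>y. if y = x then 1 else 0"] by blast
  have "x \<notin> B" using xB V.vs1.span_base by blast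
  then have "L y = 0" if "y \<in> B" for y using L(2) that by auto
  then have "L w = 0" if "w \<in> W" for w
    using V.linear_eq_0_on_span[OF L(1)] B(3) that by blast
  moreover have "L x = 1" using L(2) by simp
  ultimately show ?thesis
    using V.linear_add[OF L(1)] V.linear_scale[OF L(1)] by (intro that[of L])
qed

lemma finite_mdeg: "finite {m :: 'v::finite \<Rightarrow>\<^sub>0 nat. int (mdeg m) = d}"
proof -
  have "Poly_Mapping.lookup ` {m :: 'v \<Rightarrow>\<^sub>0 nat. int (mdeg m) = d} \<subseteq>
      {f. \<forall>x. (x \<in> UNIV \<longrightarrow> f x \<in> {..nat d}) \<and> (x \<notin> UNIV \<longrightarrow> f x = 0)}"
  proof clarsimp
    fix m :: "'v \<Rightarrow>\<^sub>0 nat" and x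
    show "Poly_Mapping.lookup m x \<le> mdeg m"
      unfolding mdeg_def by (rule member_le_sum) auto
  qed
  then have "finite (Poly_Mapping.lookup ` {m :: 'v \<Rightarrow>\<^sub>0 nat. int (mdeg m) = d})"
    by (rule finite_subset) (rule finite_set_of_finite_funs, simp_all)
  then show ?thesis by (rule finite_imageD) (rule inj_onI, rule poly_mapping_eqI, simp)
qed

context gorenstein_socle
begin

lemma ideal: "is_ideal I"
  by (rule homogeneous_ideal_is_ideal[OF hideal])

lemma const_s_mem_iff: "const a * s \<in> I \<longleftrightarrow> a = 0"
proof
  assume "const a * s \<in> I"
  then have "const (1 / a) * (const a * s) \<in> I" by (rule is_ideal_mult_left[OF ideal])
  then have "const (1 / a * a) * s \<in> I" by (simp only: const_mult mult.assoc)
  then show "a = 0" using s_notin by (cases "a = 0") simp_all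
qed (simp add: ideal.subspace_0[OF ideal])

text \<open>The coordinate of the class of \<open>p\<close> with respect to the socle generator; it
  is characterised only for \<open>p\<close> of degree \<sigma>.\<close>

definition \<phi> :: "('v, 'k) mpoly \<Rightarrow> 'k" where
  "\<phi> p = (SOME a. p - const a * s \<in> I)"

text \<open>Forms of degree \<sigma> are in the socle modulo \<open>I\<close>: otherwise
  \<open>extend\<close>, applied to a product with a variable, would give a nonzero multiplier of
  degree -1.\<close>

lemma \<phi>_mem:
  assumes "hom_of_degree \<sigma> p"
  shows "p - const (\<phi> p) * s \<in> I"
proof -
  have "var x * p \<in> I" for x
  proof (rule ccontr)
    assume "var x * p \<notin> I"
    moreover have "hom_of_degree (1 + \<sigma>) (var x * p)"
      by (rule hom_of_degree_mult[OF hom_of_degree_var assms])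
    ultimately obtain q where q: "hom_of_degree (\<sigma> - (1 + \<sigma>)) q" "q * (var x * p) \<notin> I"
      using extend by blast
    have "q = 0" by (rule hom_of_degree_neg[OF q(1)]) simp
    then show False using q(2) ideal.subspace_0[OF ideal] by simp
  qed
  then show ?thesis unfolding \<phi>_def by (rule someI_ex[OF socle])
qed

lemma \<phi>_eqI:
  assumes "hom_of_degree \<sigma> p" "p - const a * s \<in> I"
  shows "\<phi> p = a"
proof -
  have "(p - const a * s) - (p - const (\<phi> p) * s) \<in> I"
    by (rule ideal.subspace_diff[OF ideal assms(2) \<phi>_mem[OF assms(1)]])
  then have "const (\<phi> p - a) * s \<in> I" by (simp add: const_diff left_diff_distrib)
  then show ?thesis by (simp add: const_s_mem_iff)
qed

lemma \<phi>_eq_0_iff: "hom_of_degree \<sigma> p \<Longrightarrow> \<phi> p = 0 \<longleftrightarrow> p \<in> I"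
  using \<phi>_mem[of p] \<phi>_eqI[of p 0] by auto

lemma \<phi>_add:
  assumes "hom_of_degree \<sigma> p" "hom_of_degree \<sigma> q"
  shows "\<phi> (p + q) = \<phi> p + \<phi> q"
proof (rule \<phi>_eqI[OF hom_of_degree_add[OF assms]])
  have "(p - const (\<phi> p) * s) + (q - const (\<phi> q) * s) \<in> I"
    by (rule ideal.subspace_add[OF ideal \<phi>_mem[OF assms(1)] \<phi>_mem[OF assms(2)]])
  then show "p + q - const (\<phi> p + \<phi> q) * s \<in> I" by (simp add: const_add distrib_right add_diff_add)
qed

lemma \<phi>_const_mult:
  assumes "hom_of_degree \<sigma> p"
  shows "\<phi> (const a * p) = a * \<phi> p"
proof (rule \<phi>_eqI[OF hom_of_degree_const_mult[OF assms]])
  have "const a * (p - const (\<phi> p) * s) \<in> I"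
    by (rule is_ideal_mult_left[OF ideal \<phi>_mem[OF assms]])
  then show "const a * p - const (a * \<phi> p) * s \<in> I"
    by (simp add: right_diff_distrib const_mult mult.assoc)
qed

lemma \<phi>_0: "\<phi> 0 = 0"
  by (simp add: \<phi>_eq_0_iff ideal.subspace_0[OF ideal])

lemma \<phi>_sum:
  assumes "\<And>j. j \<in> S \<Longrightarrow> hom_of_degree \<sigma> (p j)"
  shows "\<phi> (\<Sum>j\<in>S. p j) = (\<Sum>j\<in>S. \<phi> (p j))"
  using assms by (induction S rule: infinite_finite_induct) (auto simp: \<phi>_0 \<phi>_add hom_of_degree_sum)

text \<open>If \<open>p \<notin> J\<close>, some functional on \<open>R\<^sub>e\<close> vanishes on \<open>J\<^sub>e\<close> and not on \<open>p\<close>. By the perfect pairing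
  \<open>(u, v) \<mapsto> \<phi> (u v)\<close> it is represented by some \<open>u\<close> of degree \<open>\<sigma> - e\<close>, which then lies in \<open>I : J\<close>.\<close>

lemma double_annihilator:
  assumes J: "homogeneous_ideal J" "I \<subseteq> J" and p: "hom_of_degree e p"
    and ann: "\<And>g. g \<in> colon I J \<Longrightarrow> hom_of_degree (\<sigma> - e) g \<Longrightarrow> g * p \<in> I"
  shows "p \<in> J"
proof -
  note iJ = homogeneous_ideal_is_ideal[OF J(1)]
  define M where "M = {m :: 'v \<Rightarrow>\<^sub>0 nat. int (mdeg m) = \<sigma> - e}"
  have finM: "finite M" unfolding M_def by (rule finite_mdeg)
  let ?X = "\<lambda>m. Poly_Mapping.single m (1 :: 'k)"
  have X: "hom_of_degree \<sigma> (?X m * v)" if "m \<in> M" "hom_of_degree e v" for m v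
    using hom_of_degree_mult[OF hom_of_degree_single[of m 1] that(2)] that(1) by (simp add: M_def)
  have const_single: "const a * Poly_Mapping.single m b = Poly_Mapping.single m (a * b)"
    for m :: "'v \<Rightarrow>\<^sub>0 nat" and a b :: 'k
    by (simp add: const_def mult_single)
  \<comment> \<open>The functional \<phi>(_ v) on forms of degree \<sigma> - e, recorded by its
    values on monomials. Storing them as coefficients of a polynomial makes
    \<open>separating_functional\<close> applicable.\<close>
  define V where "V v = (\<Sum>m\<in>M. Poly_Mapping.single m (\<phi> (?X m * v)))" for v
  have lookup_V: "Poly_Mapping.lookup (V v) m = \<phi> (?X m * v)" if "m \<in> M" for v m
    using that finM by (simp add: V_def lookup_sum lookup_single when_def)
  have V_add: "V (v + w) = V v + V w" if "hom_of_degree e v" "hom_of_degree e w" for v w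
    using that X by (simp add: V_def distrib_left \<phi>_add single_add sum.distrib)
  have V_const: "V (const a * v) = const a * V v" if "hom_of_degree e v" for a v
    using that X by (simp add: V_def mult.left_commute[of _ "const a"] \<phi>_const_mult sum_distrib_left const_single)
  define W where "W = V ` {v \<in> J. hom_of_degree e v}"
  have W_0: "0 \<in> W" unfolding W_def
    by (rule image_eqI[of _ _ 0]) (simp_all add: V_def \<phi>_0 ideal.subspace_0[OF iJ])
  have W_add: "x + y \<in> W" if xy: "x \<in> W" "y \<in> W" for x y
  proof -
    obtain v w where "x = V v" "v \<in> J" "hom_of_degree e v" "y = V w" "w \<in> J" "hom_of_degree e w"
      using xy unfolding W_def by blast
    then show ?thesis unfolding W_def
      by (intro image_eqI[of _ _ "v + w"])
        (simp_all add: V_add hom_of_degree_add ideal.subspace_add[OF iJ])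
  qed
  have W_scale: "const a * x \<in> W" if x: "x \<in> W" for a x
  proof -
    obtain v where "x = V v" "v \<in> J" "hom_of_degree e v" using x unfolding W_def by blast
    then show ?thesis unfolding W_def
      by (intro image_eqI[of _ _ "const a * v"])
        (simp_all add: V_const hom_of_degree_const_mult is_ideal_mult_left[OF iJ])
  qed
  have "V p \<in> W"
  proof (rule ccontr)
    assume "V p \<notin> W"
    from separating_functional[OF W_0 W_add W_scale this]
    obtain L :: "('v, 'k) mpoly \<Rightarrow> 'k" where L_add: "\<And>y z. L (y + z) = L y + L z"
      and L_scale: "\<And>a y. L (const a * y) = a * L y"
      and L: "L (V p) = 1" "\<And>w. w \<in> W \<Longrightarrow> L w = 0" by metis
    \<comment> \<open>The coefficients of \<open>u\<close> are the values of \<open>L\<close> on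
      monomials, which makes \<phi>(u v) equal to L (V v) for v of degree e.\<close>
    define u where "u = (\<Sum>m\<in>M. const (L (?X m)) * ?X m)"
    have L_single: "L (Poly_Mapping.single m b) = b * L (?X m)" for m b
      using L_scale[of b "?X m"] by (simp add: const_single)
    have L_sum: "L (\<Sum>m\<in>M. f m) = (\<Sum>m\<in>M. L (f m))" for f
      using L_scale[of 0 0] by (induction M rule: infinite_finite_induct) (simp_all add: L_add)
    have "hom_of_degree (\<sigma> - e) (?X m)" if "m \<in> M" for m
      using hom_of_degree_single[of m "1 :: 'k"] that by (simp add: M_def)
    then have u_hom: "hom_of_degree (\<sigma> - e) u"
      unfolding u_def by (intro hom_of_degree_sum hom_of_degree_const_mult)
    have u: "\<phi> (u * v) = L (V v)" if v: "hom_of_degree e v" for v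
    proof -
      have "\<phi> (u * v) = (\<Sum>m\<in>M. \<phi> (const (L (?X m)) * (?X m * v)))"
        unfolding u_def sum_distrib_right mult.assoc
        using X v by (intro \<phi>_sum hom_of_degree_const_mult)
      also have "\<dots> = (\<Sum>m\<in>M. \<phi> (?X m * v) * L (?X m))"
        using X v by (intro sum.cong) (simp_all add: \<phi>_const_mult)
      also have "\<dots> = L (V v)" unfolding V_def L_sum by (intro sum.cong refl L_single[symmetric])
      finally show ?thesis .
    qed
    \<comment> \<open>The functional is known to vanish only in degree e. If u q were outside
      \<open>I\<close>, \<open>extend\<close> would give r with r u q outside \<open>I\<close> and r
      q in \<open>J\<close> of degree e, where \<phi>(u _) vanishes.\<close>
    have uJ: "u * q \<in> I" if q: "q \<in> J" "hom_of_degree d q" for q d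
    proof (rule ccontr)
      assume "u * q \<notin> I"
      moreover have "hom_of_degree (\<sigma> - e + d) (u * q)" by (rule hom_of_degree_mult[OF u_hom q(2)])
      ultimately obtain r where r: "hom_of_degree (\<sigma> - (\<sigma> - e + d)) r" "r * (u * q) \<notin> I"
        using extend by blast
      have "hom_of_degree (\<sigma> - (\<sigma> - e + d) + d) (r * q)" by (rule hom_of_degree_mult[OF r(1) q(2)])
      then have rq: "hom_of_degree e (r * q)" by simp
      have "V (r * q) \<in> W" unfolding W_def using rq is_ideal_mult_left[OF iJ q(1)] by blast
      then have "\<phi> (u * (r * q)) = 0" using u[OF rq] L(2) by simp
      moreover have "hom_of_degree \<sigma> (u * (r * q))" using hom_of_degree_mult[OF u_hom rq] by simp
      ultimately have "u * (r * q) \<in> I" by (simp add: \<phi>_eq_0_iff)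
      then show False using r(2) by (simp only: mult.left_commute)
    qed
    have "u * q \<in> I" if q: "q \<in> J" for q
    proof -
      have "u * q = (\<Sum>t\<in>(\<lambda>m. int (mdeg m)) ` Poly_Mapping.keys q. u * hcomponent t q)"
        by (subst (1) sum_hcomponent[of q]) (rule sum_distrib_left)
      then show ?thesis
        using uJ[OF homogeneous_ideal_hcomponent[OF J(1) q] hom_of_degree_hcomponent]
        by (simp add: ideal.subspace_sum[OF ideal])
    qed
    then have "u \<in> colon I J" by (simp add: colon_def)
    then have "u * p \<in> I" using u_hom by (rule ann)
    moreover have "hom_of_degree \<sigma> (u * p)" using hom_of_degree_mult[OF u_hom p] by simp
    ultimately have "\<phi> (u * p) = 0" by (simp add: \<phi>_eq_0_iff)
    then show False using u[OF p] L(1) by simp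
  qed
  then obtain q where q: "V p = V q" "q \<in> J" "hom_of_degree e q" unfolding W_def by blast
  \<comment> \<open>Nondegeneracy again: \<open>V\<close> is injective modulo \<open>I\<close> in
    degree e, since a multiplier r of degree \<sigma> - e is a combination of the monomials in
    \<open>M\<close>.\<close>
  have "p - q \<in> I"
  proof (rule ccontr)
    assume "p - q \<notin> I"
    then obtain r where r: "hom_of_degree (\<sigma> - e) r" "r * (p - q) \<notin> I"
      using extend hom_of_degree_diff[OF p q(3)] by blast
    have X_mem: "?X m * (p - q) \<in> I" if m: "m \<in> M" for m
    proof -
      have "?X m * (p - q) = (?X m * p - const (\<phi> (?X m * p)) * s) - (?X m * q - const (\<phi> (?X m * q)) * s)"
        using lookup_V[OF m, of p] lookup_V[OF m, of q] q(1) by (simp add: right_diff_distrib)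
      also have "\<dots> \<in> I"
        using X[OF m] p q(3) by (intro ideal.subspace_diff[OF ideal] \<phi>_mem)
      finally show ?thesis .
    qed
    have "Poly_Mapping.keys r \<subseteq> M" using r(1) by (auto simp: hom_of_degree_def M_def)
    then have "(\<Sum>m\<in>Poly_Mapping.keys r. const (Poly_Mapping.lookup r m) * (?X m * (p - q))) \<in> I"
      by (rule ideal.subspace_sum[OF ideal is_ideal_mult_left[OF ideal X_mem[OF subsetD]]])
    also have "(\<Sum>m\<in>Poly_Mapping.keys r. const (Poly_Mapping.lookup r m) * (?X m * (p - q))) = r * (p - q)"
    proof -
      have "r * (p - q) = (\<Sum>m\<in>Poly_Mapping.keys r. Poly_Mapping.single m (Poly_Mapping.lookup r m)) * (p - q)"
        by (simp only: mpoly_sum_single)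
      then show ?thesis by (simp only: sum_distrib_right const_single mult.assoc[symmetric] mult_1_right)
    qed
    finally show False using r(2) by blast
  qed
  then have "(p - q) + q \<in> J" using J(2) q(2) by (intro ideal.subspace_add[OF iJ]) auto
  then show ?thesis by simp
qed

end

section \<open>Last syzygies and generators of the colon ideal\<close>

lemma (in resolution) generator_expansion:
  assumes "0 < c" "p \<in> I" "hom_of_degree t p"
  obtains v where "\<And>b. b < r 1 \<Longrightarrow> hom_of_degree (t - e 1 b) (v b)" "p = (\<Sum>b<r 1. D 1 0 b * v b)"
proof -
  obtain v where v: "p = (\<Sum>b<r 1. D 1 0 b * v b)"
    using assms(2) unfolding mem_iff by (rule exE)
  have "\<exists>w. (\<forall>b\<in>{..<r 1}. hom_of_degree (t - e 1 b) (w b)) \<and>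
      (\<forall>i\<in>{0}. p = (\<Sum>b<r 1. D 1 i b * w b))"
  proof (rule hom_system_solve[where \<alpha> = "\<lambda>_. 0" and v = v])
    show "hom_of_degree (e 1 j - 0) (D 1 i j)" if "i \<in> {0}" "j \<in> {..<r 1}" for i j
      using hom[OF assms(1), of 0 j] that r_0 e_0 by simp
  qed (use v assms(3) in auto)
  then obtain w where "\<forall>b\<in>{..<r 1}. hom_of_degree (t - e 1 b) (w b)" "\<forall>i\<in>{0}. p = (\<Sum>b<r 1. D 1 i b * w b)"
    by (elim exE conjE)
  then show ?thesis by (intro that[of w]) blast+
qed

context gorenstein_socle
begin

text \<open>The socle element \<open>p j\<close> has degree e c j - c and lies outside
  \<open>I\<close>, so \<open>extend\<close> gives a multiplier keeping it outside. As \<mm> carries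
  \<open>p j\<close> into \<open>I\<close>, the multiplier has a nonzero constant term and hence
  degree 0.\<close>

lemma last_degree:
  assumes K: "resolution c I r e D" and c: "c = CARD('v)" and j: "j < r c"
  shows "e c j = \<sigma> + int c"
proof -
  obtain p where p: "\<And>j. j < r c \<Longrightarrow> hom_of_degree (e c j - int c) (p j)"
    "\<And>j x. j < r c \<Longrightarrow> var x * p j \<in> I"
    "\<And>l j. (\<Sum>j<r c. const (l j) * p j) \<in> I \<Longrightarrow> j < r c \<Longrightarrow> l j = 0"
    by (rule resolution.socle_basis[OF K c]) blast
  have "p j \<notin> I"
  proof
    assume "p j \<in> I"
    moreover have "(\<Sum>i<r c. const (if i = j then 1 else 0) * p i) = p j"
      using j by (simp add: if_distrib[of const] if_distrib[of "\<lambda>a. a * _"] cong: if_cong)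
    ultimately show False using p(3)[of "\<lambda>i. if i = j then 1 else 0" j] j by simp
  qed
  then obtain q where q: "hom_of_degree (\<sigma> - (e c j - int c)) q" "q * p j \<notin> I"
    using extend[OF p(1)[OF j]] by blast
  then have "q \<notin> irrelevant_ideal" using mult_irrelevant_mem[OF ideal p(2)[OF j]] by blast
  then show ?thesis using hom_of_degree_lookup_0[OF q(1)] by (simp add: irrelevant_ideal_iff)
qed

text \<open>The socle of \<open>R/J\<close> pairs with the minimal generators of \<open>I : J\<close>: a socle element orthogonal to all
  generators of the complementary degree annihilates \<open>I : J\<close> in degree \<open>\<sigma>\<close> and hence vanishes.\<close>

lemma card_last_le_generators:
  assumes F: "resolution c J rF eF DF" and G: "resolution c (colon I J) rG eG DG"
    and c: "c = CARD('v)" and J: "homogeneous_ideal J" "I \<subseteq> J"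
  shows "card {j \<in> {..<rF c}. eF c j = t} \<le> card {i \<in> {..<rG 1}. eG 1 i = \<sigma> + int c - t}"
proof (rule ccontr)
  interpret F: resolution c J rF eF DF by (rule F)
  interpret G: resolution c "colon I J" rG eG DG by (rule G)
  let ?S = "{j \<in> {..<rF c}. eF c j = t}" and ?T = "{i \<in> {..<rG 1}. eG 1 i = \<sigma> + int c - t}"
  define d where "d = t - int c"
  have c0: "0 < c" by (simp add: c)
  obtain p where p: "\<And>j. j < rF c \<Longrightarrow> hom_of_degree (eF c j - int c) (p j)"
    "\<And>j x. j < rF c \<Longrightarrow> var x * p j \<in> J"
    "\<And>l j. (\<Sum>j<rF c. const (l j) * p j) \<in> J \<Longrightarrow> j < rF c \<Longrightarrow> l j = 0"
    by (rule F.socle_basis[OF c]) blast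
  let ?g = "DG 1 0"
  assume "\<not> card ?S \<le> card ?T"
  \<comment> \<open>With more socle elements of degree \<open>d\<close> than generators of the
    complementary degree \<sigma> - d, some nontrivial combination pairs to 0 with all these
    generators.\<close>
  then obtain l where l: "\<exists>j\<in>?S. l j \<noteq> 0" "\<forall>i\<in>?T. (\<Sum>j\<in>?S. \<phi> (?g i * p j) * l j) = 0"
    using underdetermined_system_solution[of ?T ?S "\<lambda>i j. \<phi> (?g i * p j)"] by auto
  define P where "P = (\<Sum>j\<in>?S. const (l j) * p j)"
  have P_hom: "hom_of_degree d P"
    unfolding P_def d_def using p(1) by (intro hom_of_degree_sum hom_of_degree_const_mult) auto
  have g_mem: "?g i \<in> colon I J" if "i < rG 1" for i using G.generator_mem that by simp
  have g_hom: "hom_of_degree (eG 1 i) (?g i)" if "i < rG 1" for i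
    using G.hom[OF c0, of 0 i] that by (simp add: G.r_0 G.e_0)
  have gP: "?g i * P \<in> I" if i: "i \<in> ?T" for i
  proof -
    have h: "hom_of_degree \<sigma> (?g i * p j)" if "j \<in> ?S" for j
      using hom_of_degree_mult[OF g_hom[of i] p(1)[of j]] i that by simp
    have eq: "?g i * P = (\<Sum>j\<in>?S. const (l j) * (?g i * p j))"
      by (simp add: P_def sum_distrib_left mult.left_commute)
    have "\<phi> (?g i * P) = (\<Sum>j\<in>?S. \<phi> (?g i * p j) * l j)"
      unfolding eq using h
      by (subst \<phi>_sum) (auto intro!: hom_of_degree_const_mult sum.cong simp: \<phi>_const_mult)
    then have "\<phi> (?g i * P) = 0" using l(2) i by simp
    moreover have "hom_of_degree \<sigma> (?g i * P)"
      unfolding eq using h by (intro hom_of_degree_sum hom_of_degree_const_mult)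
    ultimately show ?thesis by (simp add: \<phi>_eq_0_iff)
  qed
  have "P \<in> J"
  proof (rule double_annihilator[OF J P_hom])
    fix g assume g: "g \<in> colon I J" "hom_of_degree (\<sigma> - d) g"
    obtain v where v: "\<And>i. i < rG 1 \<Longrightarrow> hom_of_degree (\<sigma> - d - eG 1 i) (v i)"
      "g = (\<Sum>i<rG 1. ?g i * v i)"
      using G.generator_expansion[OF c0 g] by blast
    have "?g i * v i * P \<in> I" if i: "i < rG 1" for i
    proof (cases "eG 1 i = \<sigma> - d")
      case True
      then have "i \<in> ?T" using i by (simp add: d_def)
      then have "v i * (?g i * P) \<in> I" using is_ideal_mult_left[OF ideal] gP by blast
      moreover have "v i * (?g i * P) = ?g i * v i * P"
        by (simp only: mult.left_commute[of "v i"] mult.assoc)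
      ultimately show ?thesis by (simp only:)
    next
      \<comment> \<open>The coefficient of a generator of another degree has nonzero degree and so
        lies in \<mm>. It carries the socle element \<open>P\<close> into \<open>J\<close>, and the
        generator of I : J then carries the product into \<open>I\<close>.\<close>
      case False
      then have "v i \<in> irrelevant_ideal"
        using hom_of_degree_lookup_0[OF v(1)[OF i]] by (auto simp: irrelevant_ideal_iff)
      moreover have "var x * P \<in> J" for x
      proof -
        have "var x * P = (\<Sum>j\<in>?S. const (l j) * (var x * p j))"
          by (simp add: P_def sum_distrib_left mult.left_commute)
        then show ?thesis
          by (simp only:) (intro ideal.subspace_sum[OF F.is_ideal is_ideal_mult_left[OF F.is_ideal p(2)]], simp)
      qed
      ultimately have "v i * P \<in> J" using mult_irrelevant_mem[OF F.is_ideal] by blast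
      then have "?g i * (v i * P) \<in> I" using g_mem[OF i] by (simp add: colon_def)
      then show ?thesis by (simp only: mult.assoc)
    qed
    then show "g * P \<in> I"
      unfolding v(2) sum_distrib_right by (intro ideal.subspace_sum[OF ideal]) simp
  qed
  moreover have "P = (\<Sum>j<rF c. const (if j \<in> ?S then l j else 0) * p j)"
    unfolding P_def by (rule sum.mono_neutral_cong_left) auto
  ultimately have "(if j \<in> ?S then l j else 0) = 0" if "j < rF c" for j
    using p(3)[of "\<lambda>j. if j \<in> ?S then l j else 0" j] that by simp
  then show False using l(1) by fastforce
qed

end

section \<open>Syzygies of minimal generators\<close>

lemma ideal_gen_list_iff:
  "p \<in> ideal_gen (set gs) \<longleftrightarrow> (\<exists>v. p = (\<Sum>i<length gs. gs ! i * v i))"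
proof
  assume "p \<in> ideal_gen (set gs)"
  then show "\<exists>v. p = (\<Sum>i<length gs. gs ! i * v i)"
  proof (induction rule: ideal.span_induct_alt)
    case base
    show ?case by (intro exI[of _ "\<lambda>_. 0"]) simp
  next
    case (step a x y)
    then obtain v where v: "y = (\<Sum>i<length gs. gs ! i * v i)" by (elim exE)
    obtain j where j: "j < length gs" "gs ! j = x" using step(1) by (auto simp: in_set_conv_nth)
    have "a * x + y = (\<Sum>i<length gs. gs ! i * (v i + (if i = j then a else 0)))"
      using j by (simp add: v distrib_left sum.distrib if_distrib[of "\<lambda>a. _ * a"] mult.commute cong: if_cong)
    then show ?case by (intro exI[of _ "\<lambda>i. v i + (if i = j then a else 0)"])
  qed
next
  assume "\<exists>v. p = (\<Sum>i<length gs. gs ! i * v i)"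
  then obtain v where "p = (\<Sum>i<length gs. gs ! i * v i)" by (rule exE)
  then show "p \<in> ideal_gen (set gs)"
    by (simp only:) (rule ideal.subspace_sum[OF ideal.subspace_span
        is_ideal_mult_right[OF ideal.subspace_span ideal.span_base[OF nth_mem]]], simp)
qed

text \<open>In the component of the syzygy in the degree of \<open>gs ! i\<close>, the coefficient
  of \<open>gs ! i\<close> is the constant term of \<open>v i\<close>. Were it nonzero, the other
  generators would generate \<open>gs ! i\<close>.\<close>

lemma minimal_generators_syzygy:
  assumes gens: "minimal_generators I gs" and syz: "(\<Sum>i<length gs. gs ! i * v i) = 0"
    and i: "i < length gs"
  shows "v i \<in> irrelevant_ideal"
proof (rule ccontr)
  assume "v i \<notin> irrelevant_ideal"
  define a where "a = Poly_Mapping.lookup (v i) 0"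
  have a: "a \<noteq> 0" using \<open>v i \<notin> irrelevant_ideal\<close> by (simp add: a_def irrelevant_ideal_iff)
  have "\<forall>j\<in>{..<length gs}. \<exists>d. hom_of_degree d (gs ! j)"
    using gens by (auto simp: minimal_generators_def homogeneous_def)
  then obtain dg where dg: "\<forall>j\<in>{..<length gs}. hom_of_degree (dg j) (gs ! j)"
    by (rule bchoice[THEN exE])
  let ?S = "set gs - {gs ! i}"
  let ?w = "\<lambda>j. hcomponent (dg i - dg j) (v j)"
  have "0 = hcomponent (dg i) (\<Sum>j<length gs. gs ! j * v j)" by (simp add: syz)
  also have "\<dots> = (\<Sum>j<length gs. gs ! j * ?w j)"
    unfolding hcomponent_sum using dg by (intro sum.cong refl) (simp add: hcomponent_mult_hom)
  also have "\<dots> = gs ! i * ?w i + (\<Sum>j\<in>{..<length gs} - {i}. gs ! j * ?w j)"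
    using i by (subst sum.remove[of _ i]) auto
  also have "?w i = const a"
    using hom_of_degree_0_const[OF hom_of_degree_hcomponent[of 0 "v i"]]
    by (simp add: lookup_hcomponent a_def mdeg_eq_0)
  finally have "gs ! i * const a = - (\<Sum>j\<in>{..<length gs} - {i}. gs ! j * ?w j)"
    by (simp add: eq_neg_iff_add_eq_0)
  moreover have "(\<Sum>j\<in>{..<length gs} - {i}. gs ! j * ?w j) \<in> ideal_gen ?S"
  proof (intro ideal.subspace_sum[OF ideal.subspace_span] is_ideal_mult_right[OF ideal.subspace_span] ideal.span_base)
    fix j assume "j \<in> {..<length gs} - {i}"
    then show "gs ! j \<in> ?S"
      using gens i by (auto simp: minimal_generators_def nth_eq_iff_index_eq)
  qed
  ultimately have "gs ! i * const a \<in> ideal_gen ?S" by (simp add: ideal.span_neg)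
  then have "const (1 / a) * (gs ! i * const a) \<in> ideal_gen ?S" by (rule ideal.span_scale)
  also have "const (1 / a) * (gs ! i * const a) = gs ! i * const (1 / a * a)"
    by (simp only: const_mult mult.left_commute)
  finally have "gs ! i \<in> ideal_gen ?S" using a by simp
  then have "set gs \<subseteq> ideal_gen ?S" by (auto intro: ideal.span_base)
  moreover have "?S \<subseteq> ideal_gen (set gs)" by (auto intro: ideal.span_base)
  ultimately have "ideal_gen ?S = ideal_gen (set gs)" by (simp only: ideal.span_eq)
  then have "ideal_gen ?S = I" using gens by (simp add: minimal_generators_def)
  moreover have "?S \<subset> set gs" using nth_mem[OF i] by blast
  moreover have "\<forall>S. S \<subset> set gs \<longrightarrow> ideal_gen S \<noteq> I" using gens by (simp add: minimal_generators_def)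
  ultimately show False by simp
qed

text \<open>The generators of \<open>I\<close> from its resolution may replace \<open>fs\<close> in the minimal generating set
  \<open>fs @ [f]\<close>, because the two base changes are inverse to each other modulo \<open>\<mm>\<close>.\<close>

lemma (in resolution) minimal_extension_syzygy:
  assumes c: "Suc 0 < c"
    and gQ: "minimal_generators I' (fs @ [f])" and gI: "minimal_generators I fs"
    and syz: "(\<Sum>b<r 1. D 1 0 b * a b) + f * q = 0" and b: "b < r 1"
  shows "a b \<in> irrelevant_ideal"
proof -
  let ?z = "D 1 0" and ?n = "length fs"
  have I: "I = ideal_gen (set fs)" using gI by (simp add: minimal_generators_def)
  have "\<forall>b\<in>{..<r 1}. \<exists>v. ?z b = (\<Sum>i<?n. fs ! i * v i)"
    using generator_mem unfolding I ideal_gen_list_iff by blast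
  then obtain C where C: "\<forall>b\<in>{..<r 1}. ?z b = (\<Sum>i<?n. fs ! i * C b i)" by (rule bchoice[THEN exE])
  have "\<forall>i\<in>{..<?n}. \<exists>v. fs ! i = (\<Sum>b<r 1. ?z b * v b)"
    unfolding mem_iff[symmetric] I by (auto intro: ideal.span_base)
  then obtain H where H: "\<forall>i\<in>{..<?n}. fs ! i = (\<Sum>b<r 1. ?z b * H i b)" by (rule bchoice[THEN exE])
  \<comment> \<open>\<open>C\<close> writes the generators of the resolution in terms of
    \<open>fs\<close>. Thus \<open>C a\<close> together with \<open>q\<close> is a syzygy of
    \<open>fs @ [f]\<close>, to which minimality applies.\<close>
  have Ca: "(\<Sum>b<r 1. C b i * a b) \<in> irrelevant_ideal" if i: "i < ?n" for i
  proof -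
    let ?v = "\<lambda>i. if i < ?n then \<Sum>b<r 1. C b i * a b else q"
    have "(\<Sum>b<r 1. ?z b * a b) = (\<Sum>b<r 1. (\<Sum>i<?n. fs ! i * C b i) * a b)"
      using C by simp
    also have "\<dots> = (\<Sum>i<?n. fs ! i * (\<Sum>b<r 1. C b i * a b))"
      by (simp add: sum_distrib_left sum_distrib_right mult.assoc sum.swap[of _ "{..<r (Suc 0)}" "{..<?n}"])
    finally have "(\<Sum>j<length (fs @ [f]). (fs @ [f]) ! j * ?v j) = 0"
      using syz by (simp add: nth_append)
    from minimal_generators_syzygy[OF gQ this, of i] i show ?thesis by simp
  qed
  \<comment> \<open>The round trip to \<open>fs\<close> and back. The columns of E - 1 are syzygies
    of the resolution's generators, hence in \<mm>, and a = H (C a) - (E - 1) a follows.\<close>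
  define E where "E b b' = (\<Sum>i<?n. H i b * C b' i)" for b b'
  have E: "E b b' - idm b b' \<in> irrelevant_ideal" if b': "b' < r 1" for b'
  proof -
    have "(\<Sum>b<r 1. ?z b * E b b') = (\<Sum>i<?n. (\<Sum>b<r 1. ?z b * H i b) * C b' i)"
      unfolding E_def
      by (simp add: sum_distrib_left sum_distrib_right mult.assoc sum.swap[of _ "{..<r (Suc 0)}" "{..<?n}"])
    also have "\<dots> = (\<Sum>i<?n. fs ! i * C b' i)" using H by simp
    also have "\<dots> = ?z b'" using C b' by simp
    finally have "(\<Sum>b<r 1. ?z b * (E b b' - idm b b')) = 0"
      using mmul_idm_right[of "{..<r 1}" b' "D 1" 0] b'
      by (simp add: right_diff_distrib sum_subtractf mmul_def)
    then show ?thesis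
      using kernel_irrelevant[OF c, of "\<lambda>b. E b b' - idm b b'" b] b by (simp add: r_0)
  qed
  have "a b = (\<Sum>b'<r 1. idm b b' * a b')"
    using mmul_idm_left[of "{..<r 1}" b "\<lambda>b _. a b" "()"] b by (simp add: mmul_def)
  also have "\<dots> = (\<Sum>b'<r 1. E b b' * a b') - (\<Sum>b'<r 1. (E b b' - idm b b') * a b')"
    by (simp add: left_diff_distrib sum_subtractf)
  also have "(\<Sum>b'<r 1. E b b' * a b') = (\<Sum>i<?n. H i b * (\<Sum>b'<r 1. C b' i * a b'))"
    unfolding E_def
    by (simp add: sum_distrib_left sum_distrib_right mult.assoc sum.swap[of _ "{..<r (Suc 0)}" "{..<?n}"])
  finally have eq: "a b = (\<Sum>i<?n. H i b * (\<Sum>b'<r 1. C b' i * a b')) -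
    (\<Sum>b'<r 1. (E b b' - idm b b') * a b')" .
  show ?thesis
    unfolding eq
    by (intro ideal.subspace_diff[OF is_ideal_irrelevant] ideal.subspace_sum[OF is_ideal_irrelevant]
        is_ideal_mult_left[OF is_ideal_irrelevant Ca] is_ideal_mult_right[OF is_ideal_irrelevant E]) auto
qed

section \<open>Second syzygies\<close>

lemma mem_colon_insert_iff:
  assumes "is_ideal I" "J = ideal_gen (insert f S)" "I = ideal_gen S"
  shows "p \<in> colon I J \<longleftrightarrow> p * f \<in> I"
proof
  assume "p \<in> colon I J"
  then show "p * f \<in> I" by (simp add: colon_def assms(2) ideal.span_base)
next
  assume pf: "p * f \<in> I"
  have "p * q \<in> I" if "q \<in> J" for q
  proof -
    have "\<exists>k. q - k * f \<in> I" using that by (simp add: assms(2,3) ideal.span_insert)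
    then obtain k where k: "q - k * f \<in> I" by (rule exE)
    have "k * (p * f) + p * (q - k * f) \<in> I"
      by (rule ideal.subspace_add[OF assms(1) is_ideal_mult_left[OF assms(1) pf]
            is_ideal_mult_left[OF assms(1) k]])
    then show ?thesis by (simp add: right_diff_distrib mult.left_commute)
  qed
  then show "p \<in> colon I J" by (simp add: colon_def)
qed

text \<open>\<open>J\<close> is generated by the row \<open>y\<close>, consisting of
  \<open>f\<close> (index \<open>None\<close>) and the generators of \<open>I\<close> from its
  resolution. Its syzygies are generated by the columns of \<open>Y\<close>: those of
  \<open>I\<close> alone (\<open>Inl\<close>), and for each generator g of I : J one with
  coefficient g at \<open>f\<close> (\<open>Inr\<close>). Comparison with \<open>F 2\<close> gives
  an inverse modulo \<mm> on the side of \<open>F 2\<close>, hence the upper bound, and on the block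
  \<open>Inr\<close>, hence the lower bound.\<close>

lemma second_syzygy_counts:
  assumes F: "resolution c J rF eF DF" and K: "resolution c I rK eK DK"
    and G: "resolution c (colon I J) rG eG DG" and c: "3 \<le> c"
    and gQ: "minimal_generators J (fs @ [f])" and gI: "minimal_generators I fs"
    and f: "hom_of_degree d f"
  shows "card {i \<in> {..<rG 1}. eG 1 i + d = t} \<le> card {j \<in> {..<rF 2}. eF 2 j = t}" (is ?lower)
    and "card {j \<in> {..<rF 2}. eF 2 j = t} \<le>
      card {j \<in> {..<rK 2}. eK 2 j = t} + card {i \<in> {..<rG 1}. eG 1 i + d = t}" (is ?upper)
proof -
  interpret F: resolution c J rF eF DF by (rule F)
  interpret K: resolution c I rK eK DK by (rule K)
  interpret G: resolution c "colon I J" rG eG DG by (rule G)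
  have c1: "0 < c" "Suc 0 < c" "Suc (Suc 0) < c" using c by auto
  have I: "I = ideal_gen (set fs)" using gI by (simp add: minimal_generators_def)
  have J: "J = ideal_gen (insert f (set fs))" using gQ by (simp add: minimal_generators_def)
  note colon = mem_colon_insert_iff[OF K.is_ideal J I]
  note F_mem = F.mem_iff[unfolded One_nat_def] and K_mem = K.mem_iff[unfolded One_nat_def]
    and G_mem = G.mem_iff[unfolded One_nat_def]
  define A where "A = {..<rF (Suc 0)}"
  define B where "B = {..<rF (Suc (Suc 0))}"
  define T where "T = {..<rK (Suc 0)}"
  define T2 where "T2 = {..<rK (Suc (Suc 0))}"
  define U where "U = {..<rG (Suc 0)}"
  define C where "C = insert None (Some ` T)"
  define E where "E = T2 <+> U"
  have fin: "finite A" "finite B" "finite T" "finite T2" "finite U" "finite C" "finite E"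
    by (simp_all add: A_def B_def T_def T2_def U_def C_def E_def)
  have sum_C: "sum h C = h None + (\<Sum>b\<in>T. h (Some b))" for h :: "nat option \<Rightarrow> ('a, 'b) mpoly"
    using fin(3) unfolding C_def by (subst sum.insert) (auto simp: sum.reindex)
  have sum_E: "sum h E = (\<Sum>j\<in>T2. h (Inl j)) + (\<Sum>i\<in>U. h (Inr i))" for h :: "nat + nat \<Rightarrow> ('a, 'b) mpoly"
    using fin(4,5) by (simp add: E_def sum.Plus)
  let ?q = "DF (Suc 0)" and ?X = "DF (Suc (Suc 0))" and ?R = "{0 :: nat}"
  let ?z = "DK (Suc 0) 0" and ?g = "DG (Suc 0) 0"
  define y :: "nat \<Rightarrow> nat option \<Rightarrow> ('a, 'b) mpoly" where "y r = case_option f ?z" for r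
  define \<beta> where "\<beta> = case_option d (eK (Suc 0))"
  \<comment> \<open>The coefficient at \<open>f\<close> of an \<open>Inr\<close> syzygy is a
    generator of I : J, whence the shift by the degree of \<open>f\<close>.\<close>
  define \<eta> where "\<eta> = case_sum (eK (Suc (Suc 0))) (\<lambda>i. eG (Suc 0) i + d)"
  have q_hom: "hmat ?R A (\<lambda>_. 0) (eF (Suc 0)) ?q"
    using F.hom[OF c1(1), of 0] by (simp add: hmat_def A_def F.r_0 F.e_0)
  have X_hom: "hmat A B (eF (Suc 0)) (eF (Suc (Suc 0))) ?X"
    using F.hom[OF c1(2)] by (simp add: hmat_def A_def B_def)
  have z_hom: "hom_of_degree (eK (Suc 0) b) (?z b)" if "b \<in> T" for b
    using K.hom[OF c1(1), of 0 b] that by (simp add: T_def K.r_0 K.e_0)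
  have g_hom: "hom_of_degree (eG (Suc 0) i) (?g i)" if "i \<in> U" for i
    using G.hom[OF c1(1), of 0 i] that by (simp add: U_def G.r_0 G.e_0)
  have y_hom: "hmat ?R C (\<lambda>_. 0) \<beta> y"
    using f z_hom by (auto simp: hmat_def C_def y_def \<beta>_def)
  have gf: "?g i * f \<in> I" if "i \<in> U" for i
    using G.generator_mem[of i] that by (simp add: U_def colon)
  obtain s where s_hom: "hmat T U (eK (Suc 0)) (\<lambda>i. eG (Suc 0) i + d) s"
    and s: "\<And>r i. r \<in> ?R \<Longrightarrow> i \<in> U \<Longrightarrow> - (?g i * f) = mmul T (\<lambda>_. ?z) s r i"
  proof (rule hmat_lift[of T ?R "\<lambda>_. 0" "eK (Suc 0)" "\<lambda>_. ?z" U "\<lambda>i. eG (Suc 0) i + d" "\<lambda>_ i. - (?g i * f)"])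
    show "hmat ?R T (\<lambda>_. 0) (eK (Suc 0)) (\<lambda>_. ?z)" using z_hom by (simp add: hmat_def)
    show "hmat ?R U (\<lambda>_. 0) (\<lambda>i. eG (Suc 0) i + d) (\<lambda>_ i. - (?g i * f))"
      using g_hom f by (simp add: hmat_def hom_of_degree_uminus hom_of_degree_mult)
    show "\<exists>v. \<forall>r\<in>?R. - (?g i * f) = (\<Sum>t\<in>T. ?z t * v t)" if "i \<in> U" for i
    proof -
      have "- (?g i * f) \<in> I" by (rule ideal.subspace_neg[OF K.is_ideal gf[OF that]])
      then show ?thesis unfolding K_mem T_def by blast
    qed
  qed (use fin in auto)
  have s': "(\<Sum>b\<in>T. ?z b * s b i) = - (?g i * f)" if "i \<in> U" for i
    using s[of 0 i] that by (simp add: mmul_def)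
  define Y where "Y c e = (case e of
      Inl j \<Rightarrow> (case c of None \<Rightarrow> 0 | Some b \<Rightarrow> DK (Suc (Suc 0)) b j)
    | Inr i \<Rightarrow> (case c of None \<Rightarrow> ?g i | Some b \<Rightarrow> s b i))" for c e
  have Y_hom: "hmat C E \<beta> \<eta> Y"
  proof -
    have "hom_of_degree (eK (Suc (Suc 0)) j - eK (Suc 0) b) (DK (Suc (Suc 0)) b j)"
      if "b \<in> T" "j \<in> T2" for b j
      using K.hom[OF c1(2)] that by (simp add: T_def T2_def)
    then show ?thesis
      using s_hom g_hom by (auto simp: hmat_def C_def E_def Y_def \<beta>_def \<eta>_def)
  qed
  have yY: "mmul C y Y r e = 0" if "e \<in> E" for r e
    using that K.composition_0[OF c1(2), of 0] s'
    by (auto simp: mmul_def sum_C E_def Y_def y_def K.r_0 T_def T2_def mult.commute)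
  have qX: "mmul A ?q ?X r b = 0" if "r \<in> ?R" "b \<in> B" for r b
    using F.composition_0[OF c1(2), of 0 b] that by (simp add: mmul_def A_def B_def F.r_0)
  have syz_q: "\<exists>w. \<forall>a\<in>A. v a = (\<Sum>b\<in>B. ?X a b * w b)"
    if "\<forall>r\<in>?R. (\<Sum>a\<in>A. ?q r a * v a) = 0" for v
  proof -
    have "\<forall>a<rF 0. (\<Sum>b<rF (Suc 0). ?q a b * v b) = 0" using that by (simp add: A_def F.r_0)
    then show ?thesis unfolding F.exact[OF c1(2)] by (simp add: A_def B_def Ball_def)
  qed
  have syz_y: "\<exists>w. \<forall>c\<in>C. v c = (\<Sum>e\<in>E. Y c e * w e)"
    if v: "\<forall>r\<in>?R. (\<Sum>c\<in>C. y r c * v c) = 0" for v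
  proof -
    have v0: "v None * f + (\<Sum>b\<in>T. ?z b * v (Some b)) = 0"
      using v by (simp add: sum_C y_def mult.commute)
    have "v None * f = (\<Sum>b\<in>T. ?z b * - v (Some b))"
      using v0 by (simp add: sum_negf eq_neg_iff_add_eq_0)
    then have "v None * f \<in> I" unfolding K_mem T_def by (intro exI[of _ "\<lambda>b. - v (Some b)"])
    then obtain w2 where w2: "v None = (\<Sum>i\<in>U. ?g i * w2 i)"
      unfolding colon[symmetric] G_mem U_def by (rule exE)
    \<comment> \<open>Subtracting the \<open>Inr\<close> syzygies with coefficients
      \<open>w2\<close> removes the coefficient at \<open>f\<close> and leaves a syzygy of the
      generators of \<open>I\<close>.\<close>
    let ?v = "\<lambda>b. v (Some b) - (\<Sum>i\<in>U. s b i * w2 i)"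
    have "(\<Sum>b\<in>T. ?z b * ?v b) =
        (\<Sum>b\<in>T. ?z b * v (Some b)) - (\<Sum>i\<in>U. (\<Sum>b\<in>T. ?z b * s b i) * w2 i)"
      by (simp add: right_diff_distrib sum_subtractf sum_distrib_left sum_distrib_right mult.assoc
          sum.swap[of _ T U])
    also have "(\<Sum>i\<in>U. (\<Sum>b\<in>T. ?z b * s b i) * w2 i) = (\<Sum>i\<in>U. - (?g i * w2 i * f))"
      by (rule sum.cong[OF refl]) (simp only: s' minus_mult_left[symmetric] mult.assoc mult.commute[of f])
    also have "\<dots> = - (v None * f)" by (simp add: w2 sum_distrib_right sum_negf)
    also have "(\<Sum>b\<in>T. ?z b * v (Some b)) - - (v None * f) = 0" using v0 by (simp add: add.commute)
    finally have "\<forall>a<rK 0. (\<Sum>b<rK (Suc 0). DK (Suc 0) a b * ?v b) = 0"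
      by (simp add: T_def K.r_0)
    then obtain w1 where w1: "\<forall>b<rK (Suc 0). ?v b = (\<Sum>j<rK (Suc (Suc 0)). DK (Suc (Suc 0)) b j * w1 j)"
      unfolding K.exact[OF c1(2)] by (rule exE)
    have "v c = (\<Sum>e\<in>E. Y c e * case_sum w1 w2 e)" if "c \<in> C" for c
    proof (cases c)
      case None
      then show ?thesis using w2 by (simp add: sum_E Y_def)
    next
      case (Some b)
      then have "b < rK (Suc 0)" using that by (auto simp: C_def T_def)
      then have "?v b = (\<Sum>j\<in>T2. DK (Suc (Suc 0)) b j * w1 j)" using w1 by (simp add: T2_def)
      then show ?thesis using Some by (simp add: sum_E Y_def diff_eq_eq)
    qed
    then show ?thesis by blast
  qed
  have X_irr: "?X a b \<in> irrelevant_ideal" if "a \<in> A" "b \<in> B" for a b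
    using F.irr[OF c1(2)] that by (simp add: A_def B_def)
  have Y_irr: "Y c e \<in> irrelevant_ideal" if ce: "c \<in> C" "e \<in> E" for c e
  proof -
    have "s b i \<in> irrelevant_ideal" if b: "b \<in> T" and i: "i \<in> U" for b i
    proof -
      have "(\<Sum>b<rK 1. DK 1 0 b * s b i) + f * ?g i = 0" using s'[OF i] by (simp add: T_def mult.commute)
      then show ?thesis using K.minimal_extension_syzygy[OF c1(2) gQ gI] b by (simp add: T_def)
    qed
    moreover have "?g i \<in> irrelevant_ideal" if "i \<in> U" for i
      using G.irr[OF c1(1), of 0 i] that by (simp add: U_def G.r_0)
    moreover have "DK (Suc (Suc 0)) b j \<in> irrelevant_ideal" if "b \<in> T" "j \<in> T2" for b j
      using K.irr[OF c1(2)] that by (simp add: T_def T2_def)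
    ultimately show ?thesis
      using ce ideal.subspace_0[OF is_ideal_irrelevant] by (auto simp: C_def E_def Y_def)
  qed
  have J_y: "p \<in> J \<longleftrightarrow> (\<exists>v. p = (\<Sum>c\<in>C. y r c * v c))" for p r
  proof
    assume "p \<in> J"
    then obtain k where "p - k * f \<in> I" unfolding J I ideal.span_insert by blast
    then obtain w where "p - k * f = (\<Sum>b\<in>T. ?z b * w b)" unfolding K_mem T_def by (rule exE)
    then have "p = (\<Sum>c\<in>C. y r c * case_option k w c)"
      by (simp add: sum_C y_def diff_eq_eq mult.commute add.commute)
    then show "\<exists>v. p = (\<Sum>c\<in>C. y r c * v c)" by (rule exI[of _ "case_option k w"])
  next
    assume "\<exists>v. p = (\<Sum>c\<in>C. y r c * v c)"
    then obtain v where "p = (\<Sum>c\<in>C. y r c * v c)" by (rule exE)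
    then have "p - v None * f = (\<Sum>b\<in>T. ?z b * v (Some b))" by (simp add: sum_C y_def mult.commute)
    then have "p - v None * f \<in> I"
      unfolding K_mem T_def by (intro exI[of _ "\<lambda>b. v (Some b)"])
    then show "p \<in> J" unfolding J I ideal.span_insert by blast
  qed
  obtain P where P_hom: "hmat C A \<beta> (eF (Suc 0)) P"
    and P: "\<And>r a. r \<in> ?R \<Longrightarrow> a \<in> A \<Longrightarrow> ?q r a = mmul C y P r a"
  proof (rule hmat_lift[OF fin(6) y_hom q_hom])
    show "\<exists>v. \<forall>r\<in>?R. ?q r a = (\<Sum>c\<in>C. y r c * v c)" if "a \<in> A" for a
      using F.generator_mem[of a] that J_y[of "?q 0 a" 0] by (simp add: A_def)
  qed blast
  obtain P' where P'_hom: "hmat A C (eF (Suc 0)) \<beta> P'"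
    and P': "\<And>r c. r \<in> ?R \<Longrightarrow> c \<in> C \<Longrightarrow> y r c = mmul A ?q P' r c"
  proof (rule hmat_lift[OF fin(1) q_hom y_hom])
    fix c assume c: "c \<in> C"
    have "(\<Sum>c'\<in>C. y 0 c' * idm c' c) = y 0 c"
      using mmul_idm_right[OF fin(6) c, of y 0] by (simp add: mmul_def)
    then have "y 0 c \<in> J" unfolding J_y[of _ 0] by (intro exI[of _ "\<lambda>c'. idm c' c"]) simp
    then show "\<exists>v. \<forall>r\<in>?R. y r c = (\<Sum>a\<in>A. ?q r a * v a)" by (simp add: F_mem A_def)
  qed blast
  obtain M' where M'_hom: "hmat E B \<eta> (eF (Suc (Suc 0))) M'"
    and M': "\<And>c b. c \<in> C \<Longrightarrow> b \<in> B \<Longrightarrow> mmul A P ?X c b = mmul E Y M' c b"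
  proof (rule hmat_lift[OF fin(7) Y_hom hmat_mmul[OF P_hom X_hom]])
    fix b assume b: "b \<in> B"
    show "\<exists>v. \<forall>c\<in>C. mmul A P ?X c b = (\<Sum>e\<in>E. Y c e * v e)"
    proof (rule syz_y, intro ballI)
      fix r assume r: "r \<in> ?R"
      have "(\<Sum>c\<in>C. y r c * mmul A P ?X c b) = mmul A (mmul C y P) ?X r b"
        unfolding mmul_assoc by (simp add: mmul_def)
      also have "\<dots> = mmul A ?q ?X r b" using P[OF r] by (intro mmul_cong_left) simp
      finally show "(\<Sum>c\<in>C. y r c * mmul A P ?X c b) = 0" using qX[OF r b] by simp
    qed
  qed blast
  obtain M where M_hom: "hmat B E (eF (Suc (Suc 0))) \<eta> M"
    and M: "\<And>a e. a \<in> A \<Longrightarrow> e \<in> E \<Longrightarrow> mmul C P' Y a e = mmul B ?X M a e"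
  proof (rule hmat_lift[OF fin(2) X_hom hmat_mmul[OF P'_hom Y_hom]])
    fix e assume e: "e \<in> E"
    show "\<exists>v. \<forall>a\<in>A. mmul C P' Y a e = (\<Sum>b\<in>B. ?X a b * v b)"
    proof (rule syz_q, intro ballI)
      fix r assume r: "r \<in> ?R"
      have "(\<Sum>a\<in>A. ?q r a * mmul C P' Y a e) = mmul C (mmul A ?q P') Y r e"
        unfolding mmul_assoc by (simp add: mmul_def)
      also have "\<dots> = mmul C y Y r e" using P'[OF r] by (intro mmul_cong_left) simp
      finally show "(\<Sum>a\<in>A. ?q r a * mmul C P' Y a e) = 0" using yY[OF e] by simp
    qed
  qed blast
  \<comment> \<open>The kernel of F_2 \<rightarrow> F_1 has to lie in \<mm> F_2, which requires a
    third differential; this is where \<open>3 \<le> c\<close> enters.\<close>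
  have MM': "mmul E M M' b' b - idm b' b \<in> irrelevant_ideal" if b: "b \<in> B" "b' \<in> B" for b b'
  proof -
    obtain w where w: "\<forall>b'\<in>B. w b' \<in> irrelevant_ideal"
      "\<forall>a\<in>A. (\<Sum>b'\<in>B. ?X a b' * (mmul E M M' b' b - idm b' b - w b')) = 0"
      using syzygy_lift_inverse[OF fin(1,2) syz_q X_irr P P' M' M b(1)] by blast
    have "mmul E M M' b' b - idm b' b - w b' \<in> irrelevant_ideal"
      using F.kernel_irrelevant[OF c1(3), of "\<lambda>b'. mmul E M M' b' b - idm b' b - w b'" b'] w(2) b(2)
      by (simp add: A_def B_def)
    from ideal.subspace_add[OF is_ideal_irrelevant this w(1)[rule_format, OF b(2)]] show ?thesis by simp
  qed
  have UE: "Inr i \<in> E" if "i \<in> U" for i using that by (auto simp: E_def)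
  have M'M: "mmul B (\<lambda>i. M' (Inr i)) (\<lambda>b i. M b (Inr i)) i' i - idm i' i \<in> irrelevant_ideal"
    if i: "i \<in> U" "i' \<in> U" for i i'
  proof -
    obtain w where w: "\<forall>e\<in>E. w e \<in> irrelevant_ideal"
      "\<forall>c\<in>C. (\<Sum>e\<in>E. Y c e * (mmul B M' M e (Inr i) - idm e (Inr i) - w e)) = 0"
      using syzygy_lift_inverse[OF fin(6,7) syz_y Y_irr P' P M M' UE[OF i(1)]] by blast
    let ?v = "\<lambda>i'. mmul B M' M (Inr i') (Inr i) - idm (Inr i' :: nat + nat) (Inr i) - w (Inr i')"
    \<comment> \<open>The coordinate \<open>None\<close> of the relation: the columns
      \<open>Inl\<close> vanish there, and a syzygy of the generators of I : J remains.\<close>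
    have "(\<Sum>i'\<in>U. ?g i' * ?v i') = 0"
      using w(2) by (simp add: C_def sum_E Y_def)
    then have "?v i' \<in> irrelevant_ideal"
      using G.kernel_irrelevant[OF c1(2), of ?v i'] i(2) by (simp add: U_def G.r_0)
    moreover have "w (Inr i') \<in> irrelevant_ideal" using w(1) UE[OF i(2)] by blast
    ultimately have "?v i' + w (Inr i') \<in> irrelevant_ideal"
      by (rule ideal.subspace_add[OF is_ideal_irrelevant])
    then show ?thesis by (simp add: mmul_def idm_def)
  qed
  have "card {i \<in> U. eG (Suc 0) i + d = t} \<le> card {j \<in> B. eF (Suc (Suc 0)) j = t}"
  proof (rule card_degree_le[OF fin(5,2)])
    show "hmat U B (\<lambda>i. eG (Suc 0) i + d) (eF (Suc (Suc 0))) (\<lambda>i. M' (Inr i))"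
      using M'_hom UE unfolding hmat_def \<eta>_def by fastforce
    show "hmat B U (eF (Suc (Suc 0))) (\<lambda>i. eG (Suc 0) i + d) (\<lambda>b i. M b (Inr i))"
      using M_hom UE unfolding hmat_def \<eta>_def by fastforce
  qed (rule M'M)
  then show ?lower by (simp add: U_def B_def numeral_2_eq_2)
  have "card {b \<in> B. eF (Suc (Suc 0)) b = t} \<le> card {e \<in> E. \<eta> e = t}"
    by (rule card_degree_le[OF fin(2,7) M_hom M'_hom MM'])
  also have "{e \<in> E. \<eta> e = t} = {j \<in> T2. eK (Suc (Suc 0)) j = t} <+> {i \<in> U. eG (Suc 0) i + d = t}"
    by (auto simp: E_def \<eta>_def)
  also have "card \<dots> = card {j \<in> T2. eK (Suc (Suc 0)) j = t} + card {i \<in> U. eG (Suc 0) i + d = t}"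
    using fin by (intro card_Plus) auto
  finally show ?upper by (simp add: U_def B_def T2_def numeral_2_eq_2)
qed

section \<open>Graded free modules with equal basis degrees\<close>

lemma graded_hom_reindex:
  assumes h: "\<And>i. i < rank G \<Longrightarrow> h i < rank F \<and> degs F ! h i = degs G ! i"
  shows "graded_hom F G (mat (rank G) (rank F) (\<lambda>(i, j). if j = h i then 1 else 0))" (is "graded_hom F G ?A")
  unfolding graded_hom_def
proof (intro conjI allI ballI)
  fix m v assume v: "v \<in> hcomp F m"
  then have vc: "v \<in> carrier_vec (rank F)" by (simp add: hcomp_def)
  have "(?A *\<^sub>v v) $ i = v $ h i" if i: "i < rank G" for i
  proof -
    have "(?A *\<^sub>v v) $ i = (\<Sum>j<rank F. ?A $$ (i, j) * v $ j)"
      by (rule mult_mat_vec_index_sum[OF mat_carrier vc i])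
    also have "\<dots> = (\<Sum>j<rank F. if j = h i then v $ j else 0)"
      using i by (intro sum.cong) auto
    also have "\<dots> = v $ h i" using h[OF i] by simp
    finally show ?thesis .
  qed
  moreover have "hom_of_degree (m - degs G ! i) (v $ h i)" if "i < rank G" for i
    using v h[OF that] by (auto simp: hcomp_def)
  moreover have "?A *\<^sub>v v \<in> carrier_vec (rank G)" by (rule mult_mat_vec_carrier[OF mat_carrier vc])
  ultimately show "?A *\<^sub>v v \<in> hcomp G m" unfolding hcomp_def by (simp only: mem_Collect_eq) simp
qed simp

text \<open>A permutation matching the degree lists gives a permutation matrix; it and its inverse
  preserve degrees.\<close>

lemma graded_iso_of_mset_eq:
  fixes F G :: "('v::finite, 'k::field) graded_free"
  assumes "mset (degs F) = mset (degs G)"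
  shows "F \<cong>\<^sub>g G"
proof -
  obtain p where p: "p permutes {..<length (degs F)}" "permute_list p (degs F) = degs G"
    using mset_eq_permutation[OF assms[symmetric]] .
  have rank: "rank G = rank F" using mset_eq_length[OF assms] by (simp add: rank_def)
  define n where "n = rank F"
  have pn: "p i < n" if "i < n" for i
    using permutes_in_image[OF p(1), of i] that by (simp add: n_def rank_def)
  have qn: "inv_into UNIV p i < n" if "i < n" for i
    using permutes_in_image[OF permutes_inv[OF p(1)], of i] that by (simp add: n_def rank_def)
  have deg: "degs G ! i = degs F ! p i" if "i < n" for i
    using permute_list_nth[OF p(1), of i] p(2) that by (simp add: n_def rank_def)
  let ?M = "\<lambda>h. mat n n (\<lambda>(i, j). if j = h i then 1 else 0) :: ('v, 'k) mpoly mat"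
  have A: "graded_hom F G (?M p)"
    using graded_hom_reindex[of G p F] deg pn by (simp add: rank n_def)
  have B: "graded_hom G F (?M (inv_into UNIV p))"
    using graded_hom_reindex[of F "inv_into UNIV p" G] deg[OF qn] qn by (simp add: rank n_def permutes_inverses[OF p(1)])
  have mult: "?M h * ?M k = 1\<^sub>m n" if h: "\<And>i. i < n \<Longrightarrow> h i < n" "\<And>i. k (h i) = i" for h k :: "nat \<Rightarrow> nat"
  proof (rule eq_matI)
    fix i j assume ij: "i < dim_row (1\<^sub>m n :: ('v, 'k) mpoly mat)" "j < dim_col (1\<^sub>m n :: ('v, 'k) mpoly mat)"
    then have i: "i < n" and j: "j < n" by simp_all
    have "(?M h * ?M k) $$ (i, j) = (\<Sum>l<n. (if l = h i then 1 else 0) * (if j = k l then 1 else 0))"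
      using i j by (simp add: scalar_prod_def atLeast0LessThan)
    also have "\<dots> = (\<Sum>l<n. if l = h i then (if j = k l then 1 else 0) else 0)"
      by (intro sum.cong) auto
    also have "\<dots> = (if j = k (h i) then 1 else 0)" using h(1)[OF i] by simp
    finally show "(?M h * ?M k) $$ (i, j) = 1\<^sub>m n $$ (i, j)" using i j by (simp add: h(2) eq_commute)
  qed simp_all
  have "?M (inv_into UNIV p) * ?M p = 1\<^sub>m n" "?M p * ?M (inv_into UNIV p) = 1\<^sub>m n"
    using pn qn by (intro mult; simp add: permutes_inverses[OF p(1)])+
  then show ?thesis unfolding graded_iso_def using A B by (metis n_def rank)
qed

lemma count_mset_nth: "count (mset xs) t = card {i \<in> {..<length xs}. xs ! i = t}"
  by (simp add: count_mset count_list_eq_length_filter length_filter_conv_card eq_commute[of t])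

lemma graded_iso_dsum_of_subset:
  fixes F M :: "('v::finite, 'k::field) graded_free"
  assumes "mset (degs M) \<subseteq># mset (degs F)"
  obtains N where "mset (degs N) = mset (degs F) - mset (degs M)" "F \<cong>\<^sub>g M \<oplus>\<^sub>g N"
proof -
  obtain L where L: "mset L = mset (degs F) - mset (degs M)" using ex_mset by blast
  have "F \<cong>\<^sub>g M \<oplus>\<^sub>g Free L"
  proof (rule graded_iso_of_mset_eq)
    have "mset (degs (M \<oplus>\<^sub>g Free L)) = mset (degs M) + mset L" by (simp add: Defs.dsum_def)
    also have "\<dots> = mset (degs F)" using assms by (simp add: L)
    finally show "mset (degs F) = mset (degs (M \<oplus>\<^sub>g Free L))" by (rule sym)
  qed
  then show ?thesis using L by (intro that[of "Free L"]) simp_all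
qed

text \<open>The constant coefficient of \<open>A * B\<close> is 1, so some entry of \<open>A\<close>
  has a nonzero constant term and therefore degree 0.\<close>

lemma graded_iso_rank1_degree:
  fixes F :: "('v::finite, 'k::field) graded_free"
  assumes "F \<cong>\<^sub>g Free [\<theta>]"
  obtains j where "j < rank F" "degs F ! j = \<theta>"
proof -
  let ?G = "Free [\<theta>] :: ('v, 'k) graded_free"
  have rG: "rank ?G = 1" by (simp add: rank_def)
  obtain A B where AB: "graded_hom F ?G A" "graded_hom ?G F B" "A * B = 1\<^sub>m 1"
    using assms unfolding graded_iso_def rG by blast
  have c: "A \<in> carrier_mat 1 (rank F)" "B \<in> carrier_mat (rank F) 1"
    using AB rG by (simp_all add: graded_hom_def)
  have "1 = (A * B) $$ (0, 0)" by (simp add: AB(3))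
  also have "\<dots> = (\<Sum>j<rank F. A $$ (0, j) * B $$ (j, 0))"
    using c by (auto simp: scalar_prod_def atLeast0LessThan)
  finally have "Poly_Mapping.lookup (\<Sum>j<rank F. A $$ (0, j) * B $$ (j, 0)) 0 = 1"
    by (metis lookup_one_zero)
  then have "(\<Sum>j<rank F. Poly_Mapping.lookup (A $$ (0, j)) 0 * Poly_Mapping.lookup (B $$ (j, 0)) 0) = 1"
    by (simp add: lookup_sum lookup_mult_0)
  then obtain j where j: "j < rank F" "Poly_Mapping.lookup (A $$ (0, j)) 0 \<noteq> 0"
    using sum.neutral[of "{..<rank F}" "\<lambda>j. Poly_Mapping.lookup (A $$ (0, j)) 0 * Poly_Mapping.lookup (B $$ (j, 0)) 0"]
    by fastforce
  have "hom_of_degree (degs F ! j - \<theta>) (A $$ (0, j))"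
    using graded_hom_entry[OF AB(1), of 0 j] j(1) rG by simp
  then show ?thesis using hom_of_degree_lookup_0 j by (intro that[of j]) fastforce+
qed

theorem theorem3p5:
  fixes I_Q I_Z I_G :: "('v::finite, 'k::field) mpoly set"
    and fs :: "('v, 'k) mpoly list" and f :: "('v, 'k) mpoly"
    and F K G :: "nat \<Rightarrow> ('v, 'k) graded_free"
    and dF dK dG :: "nat \<Rightarrow> ('v, 'k) mpoly mat"
    and c :: nat and dstar theta_Z d :: int
  assumes "infinite (UNIV :: 'k set)"
    and "c = CARD('v)" and "c \<ge> 3"
    and "almost_gorenstein I_Q"
    and "minimal_resolution c I_Q F dF"
    and "minimal_generators I_Q (fs @ [f])"
    and "minimal_generators I_Z fs"
    and "gorenstein_ideal I_Z"
    and "minimal_resolution c I_Z K dK"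
    and "K c \<cong>\<^sub>g Free [theta_Z]"
    and "I_G = colon I_Z I_Q"
    and "minimal_resolution c I_G G dG"
    and "hom_of_degree dstar f"
    and "d = theta_Z + dstar"
  shows "(\<exists>F2'. F 2 \<cong>\<^sub>g shift (dual (F c)) (- d) \<oplus>\<^sub>g F2') \<and>
         (\<exists>K2'. direct_summand K2' (K 2) \<and> F 2 \<cong>\<^sub>g shift (G 1) (- dstar) \<oplus>\<^sub>g K2')"
proof -
  have c0: "0 < c" using assms(3) by simp
  note F = minimal_resolution_coordinates[OF assms(5) c0]
    and K = minimal_resolution_coordinates[OF assms(9) c0]
    and G = minimal_resolution_coordinates[OF assms(12)[unfolded assms(11)] c0]
  have IZ: "I_Z = ideal_gen (set fs)" and IQ: "I_Q = ideal_gen (insert f (set fs))"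
    using assms(6,7) by (simp_all add: minimal_generators_def)
  have sub: "I_Z \<subseteq> I_Q" unfolding IZ IQ by (rule ideal.span_mono) auto
  have hQ: "homogeneous_ideal I_Q" using assms(4) by (simp add: almost_gorenstein_def)
  obtain \<sigma> s where gs: "gorenstein_socle I_Z \<sigma> s" by (rule gorenstein_ideal_socle[OF assms(8)])
  obtain j where "j < rank (K c)" "degs (K c) ! j = theta_Z"
    by (rule graded_iso_rank1_degree[OF assms(10)])
  then have theta: "theta_Z = \<sigma> + int c"
    using gorenstein_socle.last_degree[OF gs K assms(2)] by simp
  have count_G1: "count (mset (degs (shift (G 1) (- dstar)))) t =
      card {i \<in> {..<rank (G 1)}. degs (G 1) ! i + dstar = t}" for t
    unfolding count_mset_nth by (rule arg_cong[of _ _ card]) (auto simp: shift_def rank_def)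
  have count_Fc: "count (mset (degs (shift (dual (F c)) (- d)))) t =
      card {i \<in> {..<rank (F c)}. degs (F c) ! i = d - t}" for t
    unfolding count_mset_nth by (rule arg_cong[of _ _ card]) (auto simp: shift_def dual_def rank_def)
  have count: "count (mset (degs M)) t = card {i \<in> {..<rank M}. degs M ! i = t}"
    for M :: "('v, 'k) graded_free" and t
    by (simp add: count_mset_nth rank_def)
  note counts = second_syzygy_counts[OF F K G assms(3,6,7,13)]
  have G1: "count (mset (degs (shift (G 1) (- dstar)))) t \<le> count (mset (degs (F 2))) t" for t
    unfolding count_G1 count[of "F 2"] by (rule counts(1))
  have "count (mset (degs (shift (dual (F c)) (- d)))) t \<le> count (mset (degs (F 2))) t" for t
  proof -
    \<comment> \<open>A basis element of degree \<open>t\<close> in the shifted dual comes from one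
      of degree \<open>d - t\<close> in \<open>F c\<close>. As \<open>d\<close> is \<sigma> + c +
      dstar, the bound for \<open>F c\<close> counts generators of \<open>I_G\<close> of degree
      \<open>t - dstar\<close>, so the shifted dual fits degreewise into the shift of
      \<open>G 1\<close>, which has already been compared with \<open>F 2\<close>.\<close>
    have "{i \<in> {..<rank (G 1)}. degs (G 1) ! i = \<sigma> + int c - (d - t)} =
        {i \<in> {..<rank (G 1)}. degs (G 1) ! i + dstar = t}"
      using theta assms(14) by auto
    then have "count (mset (degs (shift (dual (F c)) (- d)))) t \<le> count (mset (degs (shift (G 1) (- dstar)))) t"
      unfolding count_Fc count_G1
      using gorenstein_socle.card_last_le_generators[OF gs F G assms(2) hQ sub, of "d - t"] by simp
    then show ?thesis using G1 by (rule order_trans)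
  qed
  then obtain F2' where "F 2 \<cong>\<^sub>g shift (dual (F c)) (- d) \<oplus>\<^sub>g F2'"
    using graded_iso_dsum_of_subset[OF mset_subset_eqI] by blast
  moreover obtain K2' where K2': "mset (degs K2') = mset (degs (F 2)) - mset (degs (shift (G 1) (- dstar)))"
    "F 2 \<cong>\<^sub>g shift (G 1) (- dstar) \<oplus>\<^sub>g K2'"
    using graded_iso_dsum_of_subset[OF mset_subset_eqI[OF G1]] by blast
  moreover have "direct_summand K2' (K 2)"
  proof -
    have "count (mset (degs K2')) t \<le> count (mset (degs (K 2))) t" for t
    proof -
      have "count (mset (degs (F 2))) t \<le>
          count (mset (degs (K 2))) t + count (mset (degs (shift (G 1) (- dstar)))) t"
        unfolding count_G1 count[of "F 2"] count[of "K 2"] by (rule counts(2))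
      then show ?thesis by (simp add: K2'(1) le_diff_conv)
    qed
    then show ?thesis
      unfolding direct_summand_def using graded_iso_dsum_of_subset[OF mset_subset_eqI] by blast
  qed
  ultimately show ?thesis by blast
qed

end
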